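(* Let $n$ and $k$ be positive integers with $3\leq k\leq\binom{n}{2}+n$. Then \[ f(n,k)= \begin{cases} n-1 & \text{if } k=3,\\[2pt] n+k-t-2 & \text{if } k=\binom{t}{2}+t+2-s \text{ for some integers } 0\leq s\leq t-1,\ 2\leq t\leq n-2,\\[2pt] k & \text{if } \binom{n}{2}-n+4\leq k\leq \binom{n}{2}+n-3\lfloor\frac{n}{2}\rfloor, \text{ except when } n \text{ is odd and } k=\binom{n}{2}+n-3\lfloor\frac{n}{2}\rfloor,\\[2pt] \binom{n}{2}-r & \text{if } \binom{n}{2}+n-3(r+1)<k\leq\binom{n}{2}+n-3r \text{ for some integer } 0\leq r\leq \lfloor\frac{n}{2}\rfloor-1,\\ & \quad\text{or if } n \text{ is odd},\ r=\lfloor\frac{n}{2}\rfloor \text{ and } k=\binom{n}{2}+n-3\lfloor\frac{n}{2}\rfloor. \end{cases} \]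
   Context: All graphs are finite, simple and undirected. A graph is total-colored if all its edges and all its vertices are assigned colors. A path in a total-colored graph is a total monochromatic path if all its edges and all its internal vertices have the same color. A total-coloring of a connected graph $G$ is a TMC-coloring if any two vertices of $G$ are joined by a total monochromatic path. The total monochromatic connection number $tmc(G)$ of a connected graph $G$ is the maximum number of colors used in a TMC-coloring of $G$. For positive integers $n,k$, $f(n,k)$ denotes the minimum integer such that every connected graph $G$ of order $n$ with $|E(G)|\geq f(n,k)$ satisfies $tmc(G)\geq k$.
   Formalization: The minimum defining f(n,k) is taken over integers at least n-1, the least number of edges of a connected graph of order n; for k=3 every integer qualifies, so no minimum over all integers exists, and for k≥4 the value is unchanged. *)

theory Defs
  imports Complex_Main "HOL-Library.Ramsey"
begin

text \<open>An edge is the two-element set of its endpoints.\<close>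

definition simple_graph :: "'a set \<Rightarrow> 'a set set \<Rightarrow> bool" where
  "simple_graph V E \<longleftrightarrow> finite V \<and> E \<subseteq> nsets V 2"

definition is_path :: "'a set \<Rightarrow> 'a set set \<Rightarrow> 'a \<Rightarrow> 'a list \<Rightarrow> 'a \<Rightarrow> bool" where
  "is_path V E u xs v \<longleftrightarrow>
     xs \<noteq> [] \<and> hd xs = u \<and> last xs = v \<and> distinct xs \<and> set xs \<subseteq> V \<and>
     (\<forall>i. Suc i < length xs \<longrightarrow> {xs ! i, xs ! Suc i} \<in> E)"

definition path_edges :: "'a list \<Rightarrow> 'a set set" where
  "path_edges xs = {{xs ! i, xs ! Suc i} | i. Suc i < length xs}"

definition internal_vertices :: "'a list \<Rightarrow> 'a set" where
  "internal_vertices xs = set (butlast (tl xs))"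

definition connected_graph :: "'a set \<Rightarrow> 'a set set \<Rightarrow> bool" where
  "connected_graph V E \<longleftrightarrow>
     simple_graph V E \<and> V \<noteq> {} \<and> (\<forall>u\<in>V. \<forall>v\<in>V. \<exists>xs. is_path V E u xs v)"

text \<open>A total-coloring is a pair of maps, \<open>cv\<close> on vertices and \<open>ce\<close> on edges, into a common
  set of colors. Only their values on \<open>V\<close> and \<open>E\<close> matter.\<close>

definition total_monochromatic ::
    "('a \<Rightarrow> nat) \<Rightarrow> ('a set \<Rightarrow> nat) \<Rightarrow> 'a list \<Rightarrow> bool" where
  "total_monochromatic cv ce xs \<longleftrightarrow>
     (\<exists>c. (\<forall>e\<in>path_edges xs. ce e = c) \<and> (\<forall>x\<in>internal_vertices xs. cv x = c))"

definition TMC_coloring ::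
    "'a set \<Rightarrow> 'a set set \<Rightarrow> ('a \<Rightarrow> nat) \<Rightarrow> ('a set \<Rightarrow> nat) \<Rightarrow> bool" where
  "TMC_coloring V E cv ce \<longleftrightarrow>
     (\<forall>u\<in>V. \<forall>v\<in>V. u \<noteq> v \<longrightarrow> (\<exists>xs. is_path V E u xs v \<and> total_monochromatic cv ce xs))"

text \<open>For a connected graph the set below is finite (at most \<open>card V + card E\<close> colors are used)
  and nonempty (a constant coloring qualifies), so \<open>Max\<close> is meaningful.\<close>

definition tmc :: "'a set \<Rightarrow> 'a set set \<Rightarrow> nat" where
  "tmc V E = Max {card (cv ` V \<union> ce ` E) | cv ce. TMC_coloring V E cv ce}"

text \<open>Every graph of order \<open>n\<close> has an isomorphic copy with vertices in \<open>nat\<close>. Connected graphs of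
  order \<open>n\<close> have at least \<open>n - 1\<close> edges, so every smaller threshold expresses the same condition as
  \<open>n - 1\<close>; the minimum is therefore taken over thresholds \<open>m \<ge> n - 1\<close>. The minimum exists, since
  any \<open>m > n choose 2\<close> qualifies vacuously.\<close>

definition f_tmc :: "nat \<Rightarrow> nat \<Rightarrow> nat" where
  "f_tmc n k = (LEAST m. n - 1 \<le> m \<and>
     (\<forall>(V :: nat set) E. connected_graph V E \<and> card V = n \<and> card E \<ge> m \<longrightarrow> tmc V E \<ge> k))"

end

theory Submission
  imports Defs
begin

text \<open>Let \<open>G\<close> have \<open>n\<close> vertices and \<open>m\<close> edges. Giving one color to a connected dominating set and to the
  edges of a spanning tree extending it shows that \<open>tmc G \<ge> m - n + 2 + l\<close>, where \<open>l\<close> is the number of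
  remaining vertices, and \<open>l\<close> is bounded below in terms of \<open>m\<close> by the theorem of Ding, Johnson and
  Seymour. If fewer than \<open>n / 2\<close> edges are missing, a dominating vertex gives a better coloring.
  Conversely, every vertex with a non-neighbour costs one color, since the first edge of a
  monochromatic path leaving it can be charged to it. This settles the complements of star forests,
  which are extremal for large \<open>k\<close>. For small \<open>k\<close> a clique with an ear is extremal: an ear vertex that
  is internal to a monochromatic path can be contracted without losing colors.\<close>

section \<open>Edge counts and connected sets\<close>

text \<open>The thresholds come from two lower bounds. With \<open>l\<close> vertices outside a
  connected dominating set, \<open>tmc\<close> is at least \<open>|E| - n + 2 + l\<close>, and
  \<open>l = t\<close> is available from \<open>n + ((t - 1) choose 2)\<close> edges on. Hence the
  formula breaks at triangular numbers, until \<open>t = n - 2\<close>, where the bound reads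
  \<open>tmc \<ge> |E|\<close> and the threshold is \<open>k\<close> itself. With
  \<open>h < n / 2\<close> edges missing, a dominating vertex gives
  \<open>n + (n choose 2) - 3 * h\<close>: a missing edge costs itself and at most one color for
  each of its ends. Hence the steps of length three. The obstacle is the upper bound for ears.
  Charging every vertex leaves up to \<open>|E|\<close> colors, which for an ear with
  \<open>j\<close> internal vertices is \<open>j - 1\<close> more than the claim. Contraction
  shortens the ear, but needs an internal vertex that a monochromatic path crosses. If there is
  none, the ear has at most two internal vertices; with two of them, a pair of uncharged elements of
  the same color supplies the missing unit.\<close>

definition edges_in :: "'a set set \<Rightarrow> 'a set \<Rightarrow> nat" where
  "edges_in E A = card {e \<in> E. e \<subseteq> A}"

definition deg_in :: "'a set set \<Rightarrow> 'a \<Rightarrow> 'a set \<Rightarrow> nat" where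
  "deg_in E u A = card {y \<in> A. {u, y} \<in> E}"

text \<open>The vertices of \<open>S\<close> that a tree on \<open>A\<close> can acquire as leaves
  in one step. The whole edge bound is phrased through this set instead of through trees.\<close>

definition boundary :: "'a set set \<Rightarrow> 'a set \<Rightarrow> 'a set \<Rightarrow> 'a set" where
  "boundary E S A = {y \<in> S - A. \<exists>x\<in>A. {x, y} \<in> E}"

text \<open>Connectedness by cuts: growing a set by one vertex and gluing two sets then need no
  paths. \<open>connected_graph_conn\<close> and \<open>conn_connected_graph\<close> translate. The
  empty set qualifies.\<close>

definition conn :: "'a set set \<Rightarrow> 'a set \<Rightarrow> bool" where
  "conn E A \<longleftrightarrow> (\<forall>B. B \<subset> A \<longrightarrow> B \<noteq> {} \<longrightarrow> (\<exists>x\<in>B. \<exists>y\<in>A - B. {x, y} \<in> E))"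

text \<open>The cut form of: every vertex of \<open>D\<close> is reached from \<open>U\<close> by a path inside \<open>U \<union> D\<close>.\<close>

definition attached :: "'a set set \<Rightarrow> 'a set \<Rightarrow> 'a set \<Rightarrow> bool" where
  "attached E U D \<longleftrightarrow> (\<forall>B. B \<subset> D \<longrightarrow> (\<exists>x\<in>U \<union> B. \<exists>y\<in>D - B. {x, y} \<in> E))"

lemma edges_in_empty [simp]: "E \<subseteq> [V]\<^bsup>2\<^esup> \<Longrightarrow> edges_in E {} = 0"
proof -
  assume "E \<subseteq> [V]\<^bsup>2\<^esup>"
  then have "{e \<in> E. e \<subseteq> {}} = {}" by (auto simp: nsets_def)
  then show ?thesis by (simp add: edges_in_def)
qed

lemma edges_in_insert:
  assumes E: "E \<subseteq> [V]\<^bsup>2\<^esup>" and A: "finite A" "x \<notin> A"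
  shows "edges_in E (insert x A) = edges_in E A + deg_in E x A"
proof -
  have *: "{e \<in> E. e \<subseteq> insert x A} = {e \<in> E. e \<subseteq> A} \<union> (\<lambda>y. {x, y}) ` {y \<in> A. {x, y} \<in> E}"
  proof (intro equalityI subsetI)
    fix e assume e: "e \<in> {e \<in> E. e \<subseteq> insert x A}"
    show "e \<in> {e \<in> E. e \<subseteq> A} \<union> (\<lambda>y. {x, y}) ` {y \<in> A. {x, y} \<in> E}"
    proof (cases "x \<in> e")
      case True
      with e E obtain y where "e = {x, y}" "x \<noteq> y"
        by (fastforce elim: nsets2_E)
      with e show ?thesis by auto
    qed (use e in auto)
  qed (use A in auto)
  have "card ((\<lambda>y. {x, y}) ` {y \<in> A. {x, y} \<in> E}) = deg_in E x A"
    unfolding deg_in_def by (rule card_image) (auto simp: inj_on_def doubleton_eq_iff)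
  then show ?thesis
    unfolding edges_in_def * using A by (subst card_Un_disjoint) auto
qed

lemma deg_in_Un: "finite A \<Longrightarrow> finite B \<Longrightarrow> A \<inter> B = {} \<Longrightarrow>
  deg_in E u (A \<union> B) = deg_in E u A + deg_in E u B"
  unfolding deg_in_def by (subst card_Un_disjoint[symmetric]) (auto intro!: arg_cong[where f=card])

lemma edges_in_Un:
  assumes E: "E \<subseteq> [V]\<^bsup>2\<^esup>" and "finite A" "finite B" "A \<inter> B = {}"
  shows "edges_in E (A \<union> B) = edges_in E A + (\<Sum>u\<in>A. deg_in E u B) + edges_in E B"
  using assms(2,4)
proof (induction A)
  case (insert x A)
  then show ?case
    using edges_in_insert[OF E, of "A \<union> B" x] edges_in_insert[OF E, of A x] \<open>finite B\<close>
    by (simp add: deg_in_Un)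
qed (simp add: edges_in_empty[OF E])

lemma deg_in_insert: "finite A \<Longrightarrow> x \<notin> A \<Longrightarrow>
  deg_in E u (insert x A) = deg_in E u A + (if {u, x} \<in> E then 1 else 0)"
proof -
  assume A: "finite A" "x \<notin> A"
  have "{y \<in> insert x A. {u, y} \<in> E} =
      (if {u, x} \<in> E then insert x {y \<in> A. {u, y} \<in> E} else {y \<in> A. {u, y} \<in> E})" by auto
  then show ?thesis using A by (auto simp: deg_in_def)
qed

lemma sum_deg_in:
  assumes E: "E \<subseteq> [V]\<^bsup>2\<^esup>" and "finite A"
  shows "(\<Sum>u\<in>A. deg_in E u A) = 2 * edges_in E A"
  using assms(2)
proof (induction A)
  case (insert x A)
  have loop: "{x, x} \<notin> E" using E by (auto simp: nsets_def)
  have "deg_in E x A = (\<Sum>u\<in>A. if {u, x} \<in> E then 1 else 0)"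
    unfolding deg_in_def using insert.hyps(1)
    by (simp add: sum.If_cases insert_commute Collect_conj_eq)
  then show ?case
    using insert edges_in_insert[OF E, of A x] loop
    by (simp add: deg_in_insert sum.distrib)
qed (simp add: edges_in_empty[OF E])

lemma deg_in_le_card: "finite A \<Longrightarrow> deg_in E u A \<le> card A"
  unfolding deg_in_def by (rule card_mono) auto

lemma deg_in_pos: "finite A \<Longrightarrow> y \<in> A \<Longrightarrow> {u, y} \<in> E \<Longrightarrow> 1 \<le> deg_in E u A"
  unfolding deg_in_def by (simp add: Suc_le_eq card_gt_0_iff) blast

lemma edges_in_le:
  assumes E: "E \<subseteq> [V]\<^bsup>2\<^esup>" and "finite A"
  shows "2 * edges_in E A \<le> card A * (card A - 1)"
  using assms(2)
proof (induction A)
  case (insert x A)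
  have "2 * edges_in E (insert x A) \<le> card A * (card A - 1) + 2 * card A"
    using insert edges_in_insert[OF E, of A x] deg_in_le_card[of A E x] by simp
  also have "\<dots> \<le> card (insert x A) * (card (insert x A) - 1)"
    using insert by (cases "card A") (auto simp: algebra_simps)
  finally show ?case .
qed (simp add: edges_in_empty[OF E])

lemma connD:
  assumes "conn E A" "B \<subset> A" "B \<noteq> {}"
  obtains x y where "x \<in> B" "y \<in> A - B" "{x, y} \<in> E"
  using assms unfolding conn_def by meson

lemma finite_maximal_set:
  assumes "finite F" "A \<in> F"
  obtains M where "M \<in> F" "\<And>C. C \<in> F \<Longrightarrow> \<not> M \<subset> C"
proof -
  from finite_has_maximal2[OF assms] obtain M where "M \<in> F" "\<forall>C\<in>F. M \<subseteq> C \<longrightarrow> M = C" by metis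
  then show ?thesis by (intro that[of M]) auto
qed

text \<open>A subset of \<open>A\<close> that is maximal among those containing \<open>a\<close> and
  satisfying \<open>P\<close> must be \<open>A\<close>, for otherwise a cut edge lets it grow. This
  replaces induction along a spanning tree.\<close>

lemma conn_grow_induct [consumes 3, case_names single grow]:
  assumes "conn E A" "finite A" "a \<in> A"
    and "P {a}"
    and step: "\<And>B x y. \<lbrakk>a \<in> B; B \<subset> A; x \<in> B; y \<in> A - B; {x, y} \<in> E; P B\<rbrakk> \<Longrightarrow> P (insert y B)"
  shows "P A"
proof -
  let ?F = "{B. a \<in> B \<and> B \<subseteq> A \<and> P B}"
  have "finite ?F" "{a} \<in> ?F" using assms by auto
  then obtain B where B: "B \<in> ?F" and max: "\<And>C. C \<in> ?F \<Longrightarrow> \<not> B \<subset> C"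
    by (rule finite_maximal_set) blast
  have "B = A"
  proof (rule ccontr)
    assume "B \<noteq> A"
    then have "B \<subset> A" "B \<noteq> {}" using B by auto
    then obtain x y where xy: "x \<in> B" "y \<in> A - B" "{x, y} \<in> E"
      using assms(1) by (metis conn_def)
    then have "insert y B \<in> ?F" using step[of B x y] B \<open>B \<subset> A\<close> by auto
    then show False using max[of "insert y B"] xy by auto
  qed
  then show ?thesis using B by auto
qed

text \<open>A cut that misses the root is replaced by its complement, which contains it.\<close>

lemma connI_root:
  assumes "\<And>B. B \<subset> A \<Longrightarrow> a \<in> B \<Longrightarrow> \<exists>x\<in>B. \<exists>y\<in>A - B. {x, y} \<in> E"
  shows "a \<in> A \<Longrightarrow> conn E A"
  unfolding conn_def
proof (intro allI impI)
  fix B assume a: "a \<in> A" and B: "B \<subset> A" "B \<noteq> {}"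
  show "\<exists>x\<in>B. \<exists>y\<in>A - B. {x, y} \<in> E"
  proof (cases "a \<in> B")
    case False
    have "A - B \<subset> A" "a \<in> A - B" using a B False by auto
    from assms[OF this] obtain x y where "x \<in> A - B" "y \<in> B" "{y, x} \<in> E"
      by (auto simp: insert_commute)
    then show ?thesis by blast
  qed (use assms B in auto)
qed

lemma conn_singleton [simp]: "conn E {x}"
  by (auto simp: conn_def)

lemma conn_insert:
  assumes "conn E A" "x \<in> A" "{x, y} \<in> E"
  shows "conn E (insert y A)"
proof (rule connI_root)
  fix B assume B: "B \<subset> insert y A" "x \<in> B"
  show "\<exists>u\<in>B. \<exists>w\<in>insert y A - B. {u, w} \<in> E"
  proof (cases "A \<subseteq> B")
    case False
    then have "B \<inter> A \<subset> A" "B \<inter> A \<noteq> {}" using B assms by auto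
    then obtain u w where "u \<in> B \<inter> A" "w \<in> A - (B \<inter> A)" "{u, w} \<in> E"
      using assms(1) unfolding conn_def by meson
    then show ?thesis by blast
  qed (use assms B in auto)
qed (use assms in auto)

lemma conn_edges_ge:
  assumes E: "E \<subseteq> [V]\<^bsup>2\<^esup>" and "conn E A" "finite A"
  shows "card A \<le> edges_in E A + 1"
proof (cases "A = {}")
  case False
  then obtain a where "a \<in> A" by auto
  with assms(2,3) show ?thesis
  proof (induction rule: conn_grow_induct)
    case (grow B x y)
    then have fin: "finite B" "y \<notin> B" using assms(3) finite_subset by blast+
    have "x \<in> {z \<in> B. {y, z} \<in> E}" using grow by (simp add: insert_commute)
    then have "deg_in E y B \<ge> 1"
      using fin by (intro deg_in_pos[of _ x]) auto
    then show ?case using grow edges_in_insert[OF E fin] fin by simp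
  qed simp
qed simp

lemma attachedD:
  assumes "attached E U D" "B \<subset> D"
  obtains x y where "x \<in> U \<union> B" "y \<in> D - B" "{x, y} \<in> E"
  using assms unfolding attached_def by meson

lemma attached_mono: "attached E U D \<Longrightarrow> U \<subseteq> U' \<Longrightarrow> attached E U' D"
  unfolding attached_def by blast

lemma attached_empty [simp]: "attached E U {}"
  by (auto simp: attached_def)

lemma attached_Un:
  assumes "attached E U D" "attached E U' D'"
  shows "attached E (U \<union> U') (D \<union> D')"
  unfolding attached_def
proof (intro allI impI)
  fix B assume B: "B \<subset> D \<union> D'"
  then consider "B \<inter> D \<subset> D" | "B \<inter> D' \<subset> D'" by blast
  then show "\<exists>x\<in>U \<union> U' \<union> B. \<exists>y\<in>D \<union> D' - B. {x, y} \<in> E"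
  proof cases
    case 1
    from attachedD[OF assms(1) this] show ?thesis by blast
  next
    case 2
    from attachedD[OF assms(2) this] show ?thesis by blast
  qed
qed

text \<open>A cut containing all of \<open>U\<close> is a cut of \<open>D\<close>; any other is
  crossed by an edge from \<open>v\<close>.\<close>

lemma attached_insert_root:
  assumes "attached E U D" "\<And>u. u \<in> U \<Longrightarrow> {v, u} \<in> E"
  shows "attached E {v} (U \<union> D)"
  unfolding attached_def
proof (intro allI impI)
  fix B assume B: "B \<subset> U \<union> D"
  show "\<exists>x\<in>{v} \<union> B. \<exists>y\<in>U \<union> D - B. {x, y} \<in> E"
  proof (cases "U \<subseteq> B")
    case True
    then have "B \<inter> D \<subset> D" using B by auto
    from attachedD[OF assms(1) this] show ?thesis using True by blast
  qed (use assms in auto)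
qed

lemma attached_conn:
  assumes "attached E {v} D"
  shows "conn E (insert v D)"
proof (rule connI_root)
  fix B assume "B \<subset> insert v D" "v \<in> B"
  then have "B \<inter> D \<subset> D" by auto
  from attachedD[OF assms this] show "\<exists>x\<in>B. \<exists>y\<in>insert v D - B. {x, y} \<in> E"
    using \<open>v \<in> B\<close> by blast
qed auto

section \<open>Edges of a graph whose connected sets all have small boundary\<close>

lemma boundary_subset: "boundary E S A \<subseteq> S"
  by (auto simp: boundary_def)

lemma finite_boundary: "finite S \<Longrightarrow> finite (boundary E S A)"
  by (rule finite_subset[OF boundary_subset])

text \<open>Writing \<open>d = c + 1\<close> and \<open>r = s + c\<close>, the right side exceeds
  the left by \<open>2 * c * (s + 1 - \<delta>)\<close>. The excess has the form
  \<open>r * (r + 3)\<close> because the recursion below closes with it.\<close>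

lemma excess_arith:
  fixes d \<delta> r s :: nat
  assumes "\<delta> \<le> s + 1" "r + 1 = s + d" "1 \<le> d"
  shows "d * (d - 1) + 2 * (d * \<delta>) + s * (s + 3) \<le> r * (r + 3) + 2 * \<delta>"
proof -
  obtain c where c: "d = Suc c" using assms(3) by (cases d) auto
  have r: "r = s + c" using assms(2) c by simp
  have "c * \<delta> \<le> c * (s + 1)" using assms(1) by (rule mult_le_mono2)
  then show ?thesis unfolding c r by (simp add: algebra_simps)
qed

text \<open>A root \<open>a\<close> of maximum degree either reaches all of \<open>S\<close>, and then its neighbours \<open>A\<close> serve as the
  roots of \<open>S - A\<close>, or \<open>S\<close> splits into two parts without edges between them, whose excesses add up.\<close>

lemma attached_edge_bound:
  assumes E: "E \<subseteq> [V]\<^bsup>2\<^esup>" and "finite N" "finite S" "N \<inter> S = {}" "attached E N S"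
    and bd: "\<And>U D. U \<subseteq> N \<Longrightarrow> D \<subseteq> S \<Longrightarrow> attached E U D \<Longrightarrow> card (boundary E S (U \<union> D)) \<le> r + card U"
    and "u \<in> N"
  shows "2 * edges_in E S + 2 * deg_in E u S \<le> 2 * card S + r * (r + 3)"
  using assms(2-)
proof (induction "card S" arbitrary: S N r u rule: less_induct)
  case less
  note finN = \<open>finite N\<close> and finS = \<open>finite S\<close> and disj = \<open>N \<inter> S = {}\<close> and att = \<open>attached E N S\<close>
  note bd = less.prems(5)
  show ?case
  proof (cases "S = {}")
    case True
    then show ?thesis using edges_in_empty[OF E] by (simp add: deg_in_def)
  next
    case False
    then have "{} \<subset> S" by auto
    from attachedD[OF att this] obtain x0 y0 where xy0: "x0 \<in> N" "y0 \<in> S" "{x0, y0} \<in> E" by auto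
    \<comment> \<open>Maximality lets \<open>d\<close> stand in for the degree of the arbitrary root
      \<open>u\<close> in the conclusion.\<close>
    define d where "d = Max ((\<lambda>u. deg_in E u S) ` N)"
    have d_ge: "deg_in E w S \<le> d" if "w \<in> N" for w
      unfolding d_def using that finN by auto
    have "d \<in> (\<lambda>u. deg_in E u S) ` N"
      unfolding d_def using finN xy0 by (intro Max_in) auto
    then obtain a where a: "a \<in> N" "deg_in E a S = d" by auto
    have "deg_in E x0 S \<ge> 1"
      using xy0 finS by (intro deg_in_pos[of _ y0]) auto
    then have d1: "1 \<le> d" using d_ge[OF xy0(1)] by simp
    define A where "A = {y \<in> S. {a, y} \<in> E}"
    have A: "A \<subseteq> S" "card A = d" "finite A" using a finS by (auto simp: A_def deg_in_def)
    have bda: "boundary E S ({a} \<union> {}) = A" using disj a by (auto simp: boundary_def A_def)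
    have d_r: "d \<le> r + 1" using bd[of "{a}" "{}"] a A bda by simp
    \<comment> \<open>\<open>S1\<close>, the maximal attached set, is the part of \<open>S\<close>
      that \<open>a\<close> reaches inside \<open>S\<close>.\<close>
    let ?F = "{D. D \<subseteq> S \<and> attached E {a} D}"
    have "finite ?F" "{} \<in> ?F" using finS by auto
    then obtain S1 where S1: "S1 \<in> ?F" and max: "\<And>C. C \<in> ?F \<Longrightarrow> \<not> S1 \<subset> C"
      by (rule finite_maximal_set) blast
    have closed: False if "x \<in> insert a S1" "y \<in> S - S1" "{x, y} \<in> E" for x y
    proof -
      have "attached E {a} (insert y S1)"
        unfolding attached_def
      proof (intro allI impI)
        fix B assume B: "B \<subset> insert y S1"
        show "\<exists>x\<in>{a} \<union> B. \<exists>z\<in>insert y S1 - B. {x, z} \<in> E"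
        proof (cases "S1 \<subseteq> B")
          case True
          then have "y \<notin> B" using B by auto
          then show ?thesis using True that by blast
        next
          case False
          then have "B \<inter> S1 \<subset> S1" by auto
          from attachedD[OF _ this] S1 show ?thesis by blast
        qed
      qed
      then show False using max[of "insert y S1"] S1 that by auto
    qed
    have AS1: "A \<subseteq> S1" using closed[of a] A by (auto simp: A_def)
    have ud: "deg_in E u S \<le> d" using d_ge less.prems by auto
    show ?thesis
    proof (cases "S1 = S")
      case True
      \<comment> \<open>The \<open>d\<close> vertices of \<open>A\<close> turn from boundary
        vertices into roots, so the allowance \<open>r + 1\<close> of the single root
        \<open>a\<close> drops by \<open>d\<close>.\<close>
      define s where "s = r + 1 - d"
      have rs: "r + 1 = s + d" using d_r s_def by simp
      have fin': "finite (S - A)" using finS by auto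
      have att': "attached E A (S - A)"
        unfolding attached_def
      proof (intro allI impI)
        fix B assume "B \<subset> S - A"
        then have "A \<union> B \<subset> S" using A by auto
        from attachedD[OF _ this, of E "{a}"] S1 True obtain x y where
          "x \<in> {a} \<union> (A \<union> B)" "y \<in> S - (A \<union> B)" "{x, y} \<in> E" by blast
        then show "\<exists>x\<in>A \<union> B. \<exists>y\<in>S - A - B. {x, y} \<in> E" by (auto simp: A_def)
      qed
      have bd': "card (boundary E (S - A) (U \<union> D)) \<le> s + card U"
        if U: "U \<subseteq> A" and D: "D \<subseteq> S - A" and at: "attached E U D" for U D
      proof -
        have "attached E {a} (U \<union> D)" using at U by (intro attached_insert_root) (auto simp: A_def)
        then have le: "card (boundary E S ({a} \<union> (U \<union> D))) \<le> r + 1"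
          using bd[of "{a}" "U \<union> D"] U D A a by auto
        have "(A - U) \<union> boundary E (S - A) (U \<union> D) \<subseteq> boundary E S ({a} \<union> (U \<union> D))"
          using disj a D by (auto simp: boundary_def A_def)
        then have "card ((A - U) \<union> boundary E (S - A) (U \<union> D)) \<le> r + 1"
          using le finite_boundary[OF finS] card_mono order_trans by metis
        moreover have "card ((A - U) \<union> boundary E (S - A) (U \<union> D)) =
            card (A - U) + card (boundary E (S - A) (U \<union> D))"
        proof (rule card_Un_disjoint)
          show "(A - U) \<inter> boundary E (S - A) (U \<union> D) = {}" by (auto simp: boundary_def)
        qed (use A finite_boundary[OF fin'] in auto)
        moreover have "card (A - U) = d - card U" "card U \<le> d"
          using A U by (auto simp: card_Diff_subset finite_subset card_mono)
        ultimately show ?thesis using rs by linarith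
      qed
      have "A \<noteq> {}" using A d1 by auto
      define \<delta> where "\<delta> = Max ((\<lambda>w. deg_in E w (S - A)) ` A)"
      have \<delta>_ge: "deg_in E w (S - A) \<le> \<delta>" if "w \<in> A" for w
        unfolding \<delta>_def using that A by auto
      have "\<delta> \<in> (\<lambda>w. deg_in E w (S - A)) ` A"
        unfolding \<delta>_def using A \<open>A \<noteq> {}\<close> by (intro Max_in) auto
      then obtain w where w: "w \<in> A" "deg_in E w (S - A) = \<delta>" by auto
      have "{y \<in> S - A. {w, y} \<in> E} = boundary E (S - A) ({w} \<union> {})"
        using w by (auto simp: boundary_def)
      then have \<delta>s: "\<delta> \<le> s + 1" using bd'[of "{w}" "{}"] w by (simp add: deg_in_def)
      have "card (S - A) < card S" using A \<open>A \<noteq> {}\<close> finS by (intro psubset_card_mono) auto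
      from less.hyps[OF this A(3) fin' _ att' bd' w(1)]
      have ih: "2 * edges_in E (S - A) + 2 * \<delta> \<le> 2 * card (S - A) + s * (s + 3)"
        using w by auto
      \<comment> \<open>Edges inside \<open>A\<close> are bounded by those of a clique, edges
        leaving \<open>A\<close> by \<open>d * \<delta>\<close>, the rest by induction; the degree
        term of the induction hypothesis absorbs one of the \<open>d\<close> summands
        \<open>\<delta>\<close>.\<close>
      have "edges_in E S = edges_in E A + (\<Sum>u\<in>A. deg_in E u (S - A)) + edges_in E (S - A)"
        using edges_in_Un[OF E A(3) fin'] A by (simp add: Un_absorb1)
      moreover have "(\<Sum>u\<in>A. deg_in E u (S - A)) \<le> d * \<delta>"
        using sum_bounded_above[of A "\<lambda>u. deg_in E u (S - A)" \<delta>] \<delta>_ge A by simp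
      moreover have "2 * edges_in E A \<le> d * (d - 1)" using edges_in_le[OF E A(3)] A by simp
      moreover have "card (S - A) = card S - d" "d \<le> card S"
        using A finS by (auto simp: card_Diff_subset card_mono)
      moreover note excess_arith[OF \<delta>s rs d1] ih ud
      ultimately show ?thesis by linarith
    next
      case False
      define S2 where "S2 = S - S1"
      have S: "S = S1 \<union> S2" "S1 \<inter> S2 = {}" "S2 \<noteq> {}" "finite S1" "finite S2"
        using S1 False finS finite_subset by (auto simp: S2_def)
      have "S1 \<noteq> {}" using AS1 A d1 by auto
      have c1: "card S1 < card S" "card S2 < card S"
        using S \<open>S1 \<noteq> {}\<close> finS by (auto intro!: psubset_card_mono)
      have att1: "attached E N S1" using S1 a by (auto intro: attached_mono)
      have att2: "attached E N S2"
        unfolding attached_def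
      proof (intro allI impI)
        fix B assume "B \<subset> S2"
        then have "S1 \<union> B \<subset> S" using S by auto
        from attachedD[OF att this] obtain x y where
          "x \<in> N \<union> (S1 \<union> B)" "y \<in> S - (S1 \<union> B)" "{x, y} \<in> E" by blast
        then show "\<exists>x\<in>N \<union> B. \<exists>y\<in>S2 - B. {x, y} \<in> E" using closed by (auto simp: S2_def)
      qed
      let ?P = "\<lambda>q. \<forall>U D. U \<subseteq> N \<longrightarrow> D \<subseteq> S1 \<longrightarrow> attached E U D \<longrightarrow>
        card (boundary E S1 (U \<union> D)) \<le> q + card U"
      \<comment> \<open>The least allowance for \<open>S1\<close> is attained by some
        \<open>U1\<close> and \<open>D1\<close>. What they use up is lost to \<open>S2\<close>, so
        \<open>r - r1\<close> remains there.\<close>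
      define r1 where "r1 = (LEAST q. ?P q)"
      have "?P r"
      proof (intro allI impI)
        fix U D assume *: "U \<subseteq> N" "D \<subseteq> S1" "attached E U D"
        have "boundary E S1 (U \<union> D) \<subseteq> boundary E S (U \<union> D)" using S by (auto simp: boundary_def)
        then have "card (boundary E S1 (U \<union> D)) \<le> card (boundary E S (U \<union> D))"
          using finite_boundary[OF finS] by (rule card_mono[rotated])
        also have "\<dots> \<le> r + card U" using bd * S by auto
        finally show "card (boundary E S1 (U \<union> D)) \<le> r + card U" .
      qed
      then have r1: "?P r1" unfolding r1_def by (rule LeastI)
      have ex1: "\<exists>U D. U \<subseteq> N \<and> D \<subseteq> S1 \<and> attached E U D \<and> r1 + card U \<le> card (boundary E S1 (U \<union> D))"
      proof (cases r1)
        case 0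
        then show ?thesis by (intro exI[of _ "{}"]) auto
      next
        case (Suc q)
        then have "\<not> ?P q" unfolding r1_def using not_less_Least[of q ?P] by (metis lessI)
        then show ?thesis using Suc by (metis add_Suc not_less_eq_eq)
      qed
      then obtain U1 D1 where U1: "U1 \<subseteq> N" "D1 \<subseteq> S1" "attached E U1 D1"
        "r1 + card U1 \<le> card (boundary E S1 (U1 \<union> D1))" by blast
      have both: "r1 + card (boundary E S2 (U \<union> D)) \<le> r + card U"
        if U: "U \<subseteq> N" "D \<subseteq> S2" "attached E U D" for U D
      proof -
        have "boundary E S1 (U1 \<union> D1) \<union> boundary E S2 (U \<union> D)
            \<subseteq> boundary E S ((U1 \<union> U) \<union> (D1 \<union> D))"
          using U U1 disj S by (auto simp: boundary_def)
        then have "card (boundary E S1 (U1 \<union> D1) \<union> boundary E S2 (U \<union> D))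
            \<le> card (boundary E S ((U1 \<union> U) \<union> (D1 \<union> D)))"
          using finite_boundary[OF finS] by (rule card_mono[rotated])
        also have "\<dots> \<le> r + card (U1 \<union> U)"
          using bd[of "U1 \<union> U" "D1 \<union> D"] attached_Un[OF U1(3) U(3)] U U1 S by blast
        also have "\<dots> \<le> r + card U1 + card U" using card_Un_le[of U1 U] by simp
        finally have "card (boundary E S1 (U1 \<union> D1) \<union> boundary E S2 (U \<union> D)) \<le> r + card U1 + card U" .
        moreover have "card (boundary E S1 (U1 \<union> D1) \<union> boundary E S2 (U \<union> D)) =
            card (boundary E S1 (U1 \<union> D1)) + card (boundary E S2 (U \<union> D))"
          using S finite_boundary boundary_subset by (intro card_Un_disjoint) (auto simp: boundary_def)
        ultimately show ?thesis using U1 by linarith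
      qed
      have r1r: "r1 \<le> r" using both[of "{}" "{}"] by simp
      define r2 where "r2 = r - r1"
      have r: "r = r1 + r2" using r1r r2_def by simp
      have r2: "card (boundary E S2 (U \<union> D)) \<le> r2 + card U"
        if U: "U \<subseteq> N" "D \<subseteq> S2" "attached E U D" for U D
        using both[OF U] r by linarith
      have ih1: "2 * edges_in E S1 + 2 * deg_in E u S1 \<le> 2 * card S1 + r1 * (r1 + 3)"
        using less.hyps[OF c1(1) finN S(4) _ att1 _ \<open>u \<in> N\<close>, of r1] r1 disj S by blast
      have ih2: "2 * edges_in E S2 + 2 * deg_in E u S2 \<le> 2 * card S2 + r2 * (r2 + 3)"
        using less.hyps[OF c1(2) finN S(5) _ att2 _ \<open>u \<in> N\<close>, of r2] r2 disj S by blast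
      have "{y \<in> S2. {w, y} \<in> E} = {}" if "w \<in> S1" for w
        using closed that by (auto simp: S2_def)
      then have "deg_in E w S2 = 0" if "w \<in> S1" for w
        unfolding deg_in_def using that by (metis card.empty)
      then have "edges_in E S = edges_in E S1 + edges_in E S2"
        using edges_in_Un[OF E S(4,5,2)] S(1) by simp
      moreover have "deg_in E u S = deg_in E u S1 + deg_in E u S2"
        using deg_in_Un S by metis
      moreover have "card S = card S1 + card S2" using S by (metis card_Un_disjoint)
      \<comment> \<open>\<open>q * (q + 3)\<close> is superadditive in \<open>q\<close>, so the two
        bounds combine into the one for \<open>r = r1 + r2\<close>.\<close>
      ultimately show ?thesis using ih1 ih2 r by (simp add: algebra_simps)
    qed
  qed
qed


lemma two_choose_two: "2 * (n choose 2) = n * (n - 1)"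
proof -
  have "even (n * (n - 1))" by (cases n) auto
  then show ?thesis by (simp add: choose_two)
qed

lemma edges_in_compl:
  assumes E: "E \<subseteq> [V]\<^bsup>2\<^esup>" and "finite A" "A \<subseteq> V"
  shows "edges_in E A + edges_in ([V]\<^bsup>2\<^esup> - E) A = card A choose 2"
proof -
  have fin: "finite {e. e \<subseteq> A}" using assms by simp
  have "card ({e \<in> E. e \<subseteq> A} \<union> {e \<in> [V]\<^bsup>2\<^esup> - E. e \<subseteq> A}) =
      edges_in E A + edges_in ([V]\<^bsup>2\<^esup> - E) A"
    unfolding edges_in_def by (intro card_Un_disjoint) (auto intro: finite_subset[OF _ fin])
  moreover have "{e \<in> E. e \<subseteq> A} \<union> {e \<in> [V]\<^bsup>2\<^esup> - E. e \<subseteq> A} = [A]\<^bsup>2\<^esup>"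
    using assms by (auto simp: nsets_def)
  ultimately show ?thesis using card_nsets[of A 2] assms(2) by simp
qed

text \<open>The slack is \<open>(\<Delta> - 2) * (2 * r - d)\<close>, and
  \<open>d \<le> r + 1 \<le> 2 * r\<close>. For \<open>r = 0\<close> and \<open>d = 1\<close> the
  second factor is negative, which forces a separate case below.\<close>

lemma degree_arith:
  fixes \<Delta> d r s M :: nat
  assumes "2 * M + 2 * d \<le> 2 * \<Delta> + (\<Delta> * (\<Delta> - 1) + \<Delta> * d) + (2 * s + r * (r + 3))"
    and "d \<le> r + 1" "1 \<le> r" "2 \<le> \<Delta>"
  shows "2 * M \<le> 2 * (\<Delta> + s) + (\<Delta> + r) * (\<Delta> + r - 1)"
proof -
  obtain c where c: "\<Delta> = c + 2" using assms(4) by (metis add.commute le_Suc_ex)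
  have "d \<le> 2 * r" using assms(2,3) by simp
  from mult_le_mono2[OF this, of c] have cd: "c * d \<le> 2 * (c * r)" by (simp only: mult.left_commute)
  have 1: "(c + 2) * (c + 2 - 1) + (c + 2) * d = c * c + 3 * c + 2 + c * d + 2 * d"
    by (simp add: algebra_simps)
  have 2: "(c + 2 + r) * (c + 2 + r - 1) = c * c + 3 * c + 2 + 2 * (c * r) + 3 * r + r * r"
    by (simp add: algebra_simps)
  have 3: "r * (r + 3) = r * r + 3 * r" by (simp add: algebra_simps)
  have "2 * M \<le> 2 * (c + 2 + s) + (cc + 3 * c + 2 + 2 * cr + 3 * r + rr)"
    if "2 * M + 2 * d \<le> 2 * (c + 2) + (cc + 3 * c + 2 + cd + 2 * d) + (2 * s + (rr + 3 * r))"
      "cd \<le> 2 * cr" for cc cd cr rr :: nat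
    using that by simp
  from this[OF assms(1)[unfolded c 1 3] cd] show ?thesis unfolding c 2 .
qed

text \<open>The theorem of Ding, Johnson and Seymour on spanning trees with many leaves. A vertex \<open>v\<close> of maximum degree splits the rest into its neighbours and the
  remaining set \<open>S\<close>, whose edges \<open>attached_edge_bound\<close> counts; if \<open>v\<close> already has \<open>l\<close> neighbours,
  the count is too weak by a term that is recovered from the complement graph on the neighbours.\<close>

lemma edge_bound_small_boundary:
  assumes E: "E \<subseteq> [V]\<^bsup>2\<^esup>" and V: "finite V" "conn E V" and big: "l + 3 \<le> card V"
    and bd: "\<And>D. D \<subseteq> V \<Longrightarrow> D \<noteq> {} \<Longrightarrow> conn E D \<Longrightarrow> card (boundary E V D) \<le> l"
  shows "2 * card E \<le> 2 * (card V - 1) + l * (l - 1)"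
proof (rule ccontr)
  assume contra: "\<not> ?thesis"
  have loop: "{x, x} \<notin> E" for x using E by (auto simp: nsets_def)
  have inV: "x \<in> V \<and> y \<in> V" if "{x, y} \<in> E" for x y using E that by (auto simp: nsets_def)
  have EV: "edges_in E V = card E"
    unfolding edges_in_def using E by (intro arg_cong[where f = card]) (auto simp: nsets_def)
  \<comment> \<open>Negating the claim leaves at least as many edges as vertices, so the average
    degree, and with it \<open>\<Delta>\<close>, is at least two.\<close>
  have mV: "card V \<le> card E"
    using contra big by (cases "l * (l - 1) = 0") auto
  have "V \<noteq> {}" using big by auto
  define \<Delta> where "\<Delta> = Max ((\<lambda>u. deg_in E u V) ` V)"
  have \<Delta>_ge: "deg_in E u V \<le> \<Delta>" if "u \<in> V" for u
    unfolding \<Delta>_def using that V by auto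
  have "\<Delta> \<in> (\<lambda>u. deg_in E u V) ` V" unfolding \<Delta>_def using V \<open>V \<noteq> {}\<close> by (intro Max_in) auto
  then obtain v where v: "v \<in> V" "deg_in E v V = \<Delta>" by auto
  have "2 * card E \<le> card V * \<Delta>"
    using sum_deg_in[OF E V(1)] EV sum_bounded_above[of V "\<lambda>u. deg_in E u V" \<Delta>] \<Delta>_ge by simp
  then have "card V * 2 \<le> card V * \<Delta>" using mV by linarith
  then have \<Delta>2: "2 \<le> \<Delta>" using \<open>V \<noteq> {}\<close> V by auto
  define N where "N = {y \<in> V. {v, y} \<in> E}"
  define S where "S = V - insert v N"
  have N: "N \<subseteq> V" "finite N" "card N = \<Delta>" "v \<notin> N"
    using v V loop by (auto simp: N_def deg_in_def)
  have S: "finite S" "N \<inter> S = {}" "v \<notin> S" "S \<subseteq> V" using V by (auto simp: S_def)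
  have VNS: "V = insert v (N \<union> S)" using v N by (auto simp: S_def)
  have vNS: "v \<notin> N \<union> S" using N S by auto
  have cV: "card V = 1 + \<Delta> + card S"
    unfolding VNS using vNS N S by (simp add: card_Un_disjoint)
  have att: "attached E N S"
    unfolding attached_def
  proof (intro allI impI)
    fix B assume "B \<subset> S"
    then have "insert v (N \<union> B) \<subset> V" using VNS vNS S by auto
    then obtain x y where "x \<in> insert v (N \<union> B)" "y \<in> V - insert v (N \<union> B)" "{x, y} \<in> E"
      by (rule connD[OF V(2)]) auto
    then show "\<exists>x\<in>N \<union> B. \<exists>y\<in>S - B. {x, y} \<in> E" unfolding S_def N_def by blast
  qed
  have vedge: "{v, u} \<in> E" if "u \<in> N" for u using that by (simp add: N_def)
  \<comment> \<open>The connected set made of \<open>v\<close>, \<open>U\<close> and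
    \<open>D\<close> still has \<open>N - U\<close> in its boundary, besides the part in
    \<open>S\<close>. This is the premise of \<open>attached_edge_bound\<close> with
    \<open>r = l - \<Delta>\<close>.\<close>
  have gain: "\<Delta> + card (boundary E S (U \<union> D)) \<le> l + card U"
    if U: "U \<subseteq> N" "D \<subseteq> S" "attached E U D" for U D
  proof -
    have "conn E (insert v (U \<union> D))"
      using U vedge by (intro attached_conn attached_insert_root) auto
    then have le: "card (boundary E V (insert v (U \<union> D))) \<le> l" using U VNS by (intro bd) auto
    have "(N - U) \<union> boundary E S (U \<union> D) \<subseteq> boundary E V (insert v (U \<union> D))"
      using U S N vedge by (auto simp: boundary_def)
    then have "card ((N - U) \<union> boundary E S (U \<union> D)) \<le> l"
      using le finite_boundary[OF V(1)] card_mono order_trans by metis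
    moreover have "card ((N - U) \<union> boundary E S (U \<union> D)) =
        card (N - U) + card (boundary E S (U \<union> D))"
      using N S finite_boundary[OF S(1)] boundary_subset[of E S]
      by (intro card_Un_disjoint) blast+
    moreover have "card (N - U) = \<Delta> - card U" "card U \<le> \<Delta>"
      using N U by (auto simp: card_Diff_subset finite_subset card_mono)
    ultimately show ?thesis by linarith
  qed
  have \<Delta>l: "\<Delta> \<le> l" using gain[of "{}" "{}"] by simp
  define r where "r = l - \<Delta>"
  have l: "l = \<Delta> + r" using \<Delta>l r_def by simp
  have bound: "2 * edges_in E S + 2 * deg_in E u S \<le> 2 * card S + r * (r + 3)" if "u \<in> N" for u
    using attached_edge_bound[OF E N(2) S(1,2) att _ that, of r] gain l by fastforce
  have degS: "deg_in E u S \<le> r + 1" if "u \<in> N" for u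
  proof -
    have "{y \<in> S. {u, y} \<in> E} = boundary E S ({u} \<union> {})" using that S by (auto simp: boundary_def)
    then show ?thesis using gain[of "{u}" "{}"] that l by (simp add: deg_in_def)
  qed
  \<comment> \<open>One of the at most \<open>\<Delta>\<close> neighbours of \<open>u\<close> is
    \<open>v\<close>, which lies outside \<open>N \<union> S\<close>.\<close>
  have degNS: "deg_in E u N + deg_in E u S \<le> \<Delta> - 1" if "u \<in> N" for u
  proof -
    have "deg_in E u V = deg_in E u N + deg_in E u S + 1"
      unfolding VNS using vedge[OF that] vNS N S
      by (simp add: deg_in_insert deg_in_Un insert_commute)
    then show ?thesis using \<Delta>_ge[of u] that N by auto
  qed
  have "edges_in E V = edges_in E (N \<union> S) + deg_in E v (N \<union> S)"
    unfolding VNS using edges_in_insert[OF E _ vNS] N S by simp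
  moreover have "deg_in E v (N \<union> S) = \<Delta>"
    unfolding N(3)[symmetric] deg_in_def N_def S_def by (intro arg_cong[where f = card]) auto
  moreover have "edges_in E (N \<union> S) = edges_in E N + (\<Sum>u\<in>N. deg_in E u S) + edges_in E S"
    using edges_in_Un[OF E N(2) S(1,2)] .
  ultimately have m: "card E = \<Delta> + edges_in E N + (\<Sum>u\<in>N. deg_in E u S) + edges_in E S"
    using EV by simp
  show False
  proof (cases "r = 0")
    case False
    define d where "d = Max ((\<lambda>u. deg_in E u S) ` N)"
    have "N \<noteq> {}" using N \<Delta>2 by auto
    have d_ge: "deg_in E u S \<le> d" if "u \<in> N" for u
      unfolding d_def using that N by auto
    have "d \<in> (\<lambda>u. deg_in E u S) ` N" unfolding d_def using N \<open>N \<noteq> {}\<close> by (intro Max_in) auto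
    then obtain u where u: "u \<in> N" "deg_in E u S = d" by auto
    \<comment> \<open>The degree sum counts edges inside \<open>N\<close> twice but edges from
      \<open>N\<close> to \<open>S\<close> only once; their second copy is bounded by
      \<open>\<Delta> * d\<close>.\<close>
    have 1: "2 * edges_in E N + (\<Sum>u\<in>N. deg_in E u S) \<le> \<Delta> * (\<Delta> - 1)"
      using sum_bounded_above[of N "\<lambda>u. deg_in E u N + deg_in E u S" "\<Delta> - 1"] degNS
        sum_deg_in[OF E N(2)] N by (simp add: sum.distrib)
    have 2: "(\<Sum>u\<in>N. deg_in E u S) \<le> \<Delta> * d"
      using sum_bounded_above[of N "\<lambda>u. deg_in E u S" d] d_ge N by simp
    have "2 * card E \<le> 2 * (\<Delta> + card S) + (\<Delta> + r) * (\<Delta> + r - 1)"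
    proof (rule degree_arith)
      show "2 * card E + 2 * d \<le> 2 * \<Delta> + (\<Delta> * (\<Delta> - 1) + \<Delta> * d) + (2 * card S + r * (r + 3))"
        using 1 2 m bound[OF u(1)] u(2) by linarith
    qed (use u degS False \<Delta>2 in auto)
    then show False using contra cV l by simp
  next
    case True
    \<comment> \<open>No slack remains: a vertex of \<open>N\<close> has at most one neighbour in
      \<open>S\<close>, and any connected set with \<open>\<Delta> + 1\<close> boundary vertices is
      a contradiction. It remains to bound the number of edges from \<open>N\<close> to
      \<open>S\<close> by the number of non-adjacent pairs in \<open>N\<close> plus one.\<close>
    have lD: "l = \<Delta>" using l True by simp
    have S2: "2 \<le> card S" using big cV lD by simp
    define P where "P = {u \<in> N. \<exists>y\<in>S. {u, y} \<in> E}"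
    have P: "P \<subseteq> N" "finite P" using N by (auto simp: P_def finite_subset)
    obtain \<sigma> where \<sigma>: "\<And>u. u \<in> P \<Longrightarrow> \<sigma> u \<in> S \<and> {u, \<sigma> u} \<in> E"
    proof -
      have "\<forall>u\<in>P. \<exists>y. y \<in> S \<and> {u, y} \<in> E" by (auto simp: P_def)
      then show ?thesis using that by metis
    qed
    have uniq: "y = \<sigma> u" if "u \<in> N" "y \<in> S" "{u, y} \<in> E" for u y
    proof (rule ccontr)
      assume "y \<noteq> \<sigma> u"
      have "u \<in> P" using that by (auto simp: P_def)
      then have "{y, \<sigma> u} \<subseteq> {y \<in> S. {u, y} \<in> E}" using that \<sigma> by auto
      then have "card {y, \<sigma> u} \<le> deg_in E u S"
        unfolding deg_in_def using S by (intro card_mono) auto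
      then show False using degS[OF that(1)] True \<open>y \<noteq> \<sigma> u\<close> by simp
    qed
    have "deg_in E u S = (if u \<in> P then 1 else 0)" if "u \<in> N" for u
    proof -
      have "{y \<in> S. {u, y} \<in> E} = (if u \<in> P then {\<sigma> u} else {})"
        using uniq[OF that] \<sigma> that by (auto simp: P_def)
      then show ?thesis by (simp add: deg_in_def)
    qed
    then have sumP: "(\<Sum>u\<in>N. deg_in E u S) = card P"
      using N P by (simp add: sum.If_cases Int_absorb1)
    have "{} \<subset> S" using S2 by auto
    from attachedD[OF att this] obtain p y where "p \<in> N" "y \<in> S" "{p, y} \<in> E"
      by blast
    then have p: "p \<in> P" by (auto simp: P_def)
    have "deg_in E p S \<ge> 1" using \<sigma>[OF p] S by (intro deg_in_pos[of _ "\<sigma> p"]) auto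
    then have eS: "edges_in E S + 1 \<le> card S" using bound[of p] p P True by auto
    let ?F = "[V]\<^bsup>2\<^esup> - E"
    have F: "?F \<subseteq> [V]\<^bsup>2\<^esup>" by auto
    have compl: "edges_in E N + edges_in ?F N = \<Delta> choose 2"
      using edges_in_compl[OF E N(2,1)] N by simp
    have "card P \<le> edges_in ?F N + 1"
    proof -
      \<comment> \<open>\<open>C\<close> is the component of \<open>p\<close> in the complement
        graph on \<open>N\<close>, so in \<open>E\<close> each of its vertices is adjacent to all of
        \<open>N - C\<close>. If it contains \<open>P\<close>, its spanning tree has enough
        non-adjacent pairs.\<close>
      let ?C = "{C. C \<subseteq> N \<and> p \<in> C \<and> conn ?F C}"
      have "finite ?C" "{p} \<in> ?C" using N p P by auto
      then obtain C where C: "C \<in> ?C" and max: "\<And>D. D \<in> ?C \<Longrightarrow> \<not> C \<subset> D"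
        by (rule finite_maximal_set) blast
      have "finite C" using C N finite_subset by auto
      have CE: "{x, y} \<in> E" if "x \<in> C" "y \<in> N - C" for x y
      proof (rule ccontr)
        assume "{x, y} \<notin> E"
        then have "conn ?F (insert y C)" using that C N by (intro conn_insert[of _ _ x]) auto
        then show False using max[of "insert y C"] that C by auto
      qed
      show ?thesis
      proof (cases "P \<subseteq> C")
        case True
        have "card P \<le> card C" using True \<open>finite C\<close> by (rule card_mono[rotated])
        also have "\<dots> \<le> edges_in ?F C + 1" using conn_edges_ge[OF F _ \<open>finite C\<close>] C by auto
        also have "edges_in ?F C \<le> edges_in ?F N"
          unfolding edges_in_def using C N by (intro card_mono) (auto intro: finite_subset[of _ "Pow N"])
        finally show ?thesis by simp
      next
        case False
        then obtain q where q: "q \<in> P" "q \<notin> C" by auto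
        \<comment> \<open>With different partners in \<open>S\<close>, the edge
          \<open>{a, b}\<close> would see \<open>v\<close>, both partners and the other
          \<open>\<Delta> - 2\<close> vertices of \<open>N\<close>, which makes
          \<open>\<Delta> + 1\<close>.\<close>
        have same: "\<sigma> a = \<sigma> b" if "a \<in> P" "a \<in> C" "b \<in> P" "b \<notin> C" for a b
        proof (rule ccontr)
          assume ne: "\<sigma> a \<noteq> \<sigma> b"
          have ab: "{a, b} \<in> E" using that CE P by auto
          have "conn E {b, a}" using conn_insert[of E "{a}" a b] ab by simp
          then have le: "card (boundary E V {b, a}) \<le> l" using that P N by (intro bd) auto
          have "insert v ((N - {a, b}) \<union> {\<sigma> a, \<sigma> b}) \<subseteq> boundary E V {b, a}"
          proof -
            have "z \<in> boundary E V {b, a}" if z: "z \<in> N - {a, b}" for z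
              using CE[of a z] CE[of z b] z \<open>a \<in> C\<close> \<open>b \<notin> C\<close> \<open>b \<in> P\<close> P N
              by (auto simp: boundary_def insert_commute)
            moreover have "v \<in> boundary E V {b, a}"
              using vedge[of a] that P N v by (auto simp: boundary_def insert_commute)
            moreover have "\<sigma> a \<in> boundary E V {b, a}" "\<sigma> b \<in> boundary E V {b, a}"
              using \<sigma>[of a] \<sigma>[of b] that P S by (auto simp: boundary_def)
            ultimately show ?thesis by blast
          qed
          then have "card (insert v ((N - {a, b}) \<union> {\<sigma> a, \<sigma> b})) \<le> l"
            using le finite_boundary[OF V(1)] card_mono order_trans by metis
          moreover have "card (insert v ((N - {a, b}) \<union> {\<sigma> a, \<sigma> b})) = Suc (card ((N - {a, b}) \<union> {\<sigma> a, \<sigma> b}))"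
            using N S \<sigma>[of a] \<sigma>[of b] that by (intro card_insert_disjoint) auto
          moreover have "card ((N - {a, b}) \<union> {\<sigma> a, \<sigma> b}) = card (N - {a, b}) + card {\<sigma> a, \<sigma> b}"
            using N S \<sigma>[of a] \<sigma>[of b] that by (intro card_Un_disjoint) auto
          moreover have "card (N - {a, b}) = \<Delta> - 2"
          proof -
            have "a \<noteq> b" "{a, b} \<subseteq> N" using that P by auto
            then show ?thesis using N by (simp add: card_Diff_subset)
          qed
          ultimately show False using ne lD \<Delta>2 by simp
        qed
        define w where "w = \<sigma> p"
        have w: "\<sigma> u = w" if "u \<in> P" for u
        proof (cases "u \<in> C")
          case True
          then show ?thesis using same[of u q] same[of p q] that p q C by (simp add: w_def)
        next
          case False
          then show ?thesis using same[of p u] that p C by (simp add: w_def)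
        qed
        have wS: "w \<in> S" using \<sigma>[OF p] w_def by simp
        have "card {w} < card S" using S2 by simp
        \<comment> \<open>All of \<open>P\<close> has the single partner \<open>w\<close>, so the
          rest of \<open>S\<close> is reached only through \<open>w\<close>, which yields its
          neighbour \<open>s\<close>.\<close>
        then have "{w} \<subset> S" using wS by auto
        from attachedD[OF att this] obtain x s where xs: "x \<in> N \<union> {w}" "s \<in> S - {w}" "{x, s} \<in> E"
          by blast
        have "x = w"
        proof (rule ccontr)
          assume "x \<noteq> w"
          then have "x \<in> N" using xs by auto
          then show False using uniq[of x s] w[of x] xs by (auto simp: P_def)
        qed
        \<comment> \<open>Otherwise the edge \<open>{w, a}\<close> sees \<open>v\<close>,
          \<open>s\<close> and all of \<open>N - {a}\<close>: members of \<open>P\<close> through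
          \<open>w\<close>, the others through \<open>a\<close>.\<close>
        have ex: "\<exists>z. z \<in> N - P \<and> {a, z} \<notin> E" if a: "a \<in> P" for a
        proof (rule ccontr)
          assume no: "\<nexists>z. z \<in> N - P \<and> {a, z} \<notin> E"
          have aw: "{a, w} \<in> E" "a \<in> N" using \<sigma>[OF a] w[OF a] a P by auto
          have "conn E {w, a}" using conn_insert[of E "{a}" a w] aw by simp
          then have le: "card (boundary E V {w, a}) \<le> l" using aw wS N S by (intro bd) auto
          have "insert v (insert s (N - {a})) \<subseteq> boundary E V {w, a}"
          proof -
            have "z \<in> boundary E V {w, a}" if z: "z \<in> N - {a}" for z
            proof (cases "z \<in> P")
              case True
              then show ?thesis using \<sigma>[of z] w[of z] z N S by (auto simp: boundary_def insert_commute)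
            next
              case False
              then show ?thesis using no z N S wS by (auto simp: boundary_def)
            qed
            moreover have "v \<in> boundary E V {w, a}"
              using vedge[of a] aw wS N S v by (auto simp: boundary_def insert_commute)
            moreover have "s \<in> boundary E V {w, a}"
              using xs \<open>x = w\<close> aw S by (auto simp: boundary_def)
            ultimately show ?thesis by blast
          qed
          then have "card (insert v (insert s (N - {a}))) \<le> l"
            using le finite_boundary[OF V(1)] card_mono order_trans by metis
          moreover have "s \<notin> N - {a}" "v \<notin> insert s (N - {a})" using xs S N by auto
          ultimately show False using N aw lD \<Delta>2 by simp
        qed
        then obtain z where z: "\<And>a. a \<in> P \<Longrightarrow> z a \<in> N - P \<and> {a, z a} \<notin> E" by metis
        \<comment> \<open>As \<open>z a\<close> lies outside \<open>P\<close>, distinct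
          \<open>a\<close> give distinct non-adjacent pairs.\<close>
        have "card P = card ((\<lambda>a. {a, z a}) ` P)"
        proof (rule card_image[symmetric], rule inj_onI)
          fix a b assume "a \<in> P" "b \<in> P" "{a, z a} = {b, z b}"
          then show "a = b" using z[of a] z[of b] by (auto simp: doubleton_eq_iff)
        qed
        also have "\<dots> \<le> edges_in ?F N"
          unfolding edges_in_def
        proof (rule card_mono)
          show "finite {e \<in> ?F. e \<subseteq> N}" using N by (auto intro: finite_subset[of _ "Pow N"])
          show "(\<lambda>a. {a, z a}) ` P \<subseteq> {e \<in> ?F. e \<subseteq> N}" using z P N by fastforce
        qed
        finally show ?thesis by simp
      qed
    qed
    then have "2 * edges_in E N + 2 * card P \<le> 2 * (\<Delta> choose 2) + 2" using compl by simp
    moreover have "2 * (\<Delta> choose 2) = \<Delta> * (\<Delta> - 1)"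
      by (rule two_choose_two)
    moreover have "card V - 1 = \<Delta> + card S" using cV by simp
    ultimately show False using contra[unfolded lD] m sumP eS by linarith
  qed
qed

section \<open>Total colorings and walks\<close>

text \<open>There is at least one step, \<open>P\<close> binds interior vertices only, and vertices
  may repeat. Such walks can be composed and reversed, which is awkward for lists of distinct
  vertices.\<close>

inductive walk :: "('a \<Rightarrow> 'a \<Rightarrow> bool) \<Rightarrow> ('a \<Rightarrow> bool) \<Rightarrow> 'a \<Rightarrow> 'a \<Rightarrow> bool" for R P where
  edge: "R u v \<Longrightarrow> walk R P u v"
| step: "R u y \<Longrightarrow> P y \<Longrightarrow> walk R P y v \<Longrightarrow> walk R P u v"

lemma walk_trans: "walk R P u y \<Longrightarrow> P y \<Longrightarrow> walk R P y v \<Longrightarrow> walk R P u v"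
  by (induction rule: walk.induct) (auto intro: walk.step)

lemma walk_sym:
  assumes "walk R P u v" and sym: "\<And>x y. R x y \<Longrightarrow> R y x"
  shows "walk R P v u"
  using assms(1)
  by (induction rule: walk.induct) (auto intro: walk.edge walk_trans sym)

lemma walk_mono:
  assumes "walk R P u v" "\<And>x y. R x y \<Longrightarrow> R' x y" "\<And>x. P x \<Longrightarrow> P' x"
  shows "walk R' P' u v"
  using assms(1) by (induction rule: walk.induct) (auto intro: walk.intros assms(2,3))

lemma walk_last: "walk R P u v \<Longrightarrow> R u v \<or> (\<exists>z. R z v \<and> P z)"
  by (induction rule: walk.induct) auto

lemma walk_cross: "walk R P u v \<Longrightarrow> u \<in> B \<Longrightarrow> v \<notin> B \<Longrightarrow> \<exists>x y. x \<in> B \<and> y \<notin> B \<and> R x y"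
  by (induction rule: walk.induct) auto

lemma walk_of_list:
  assumes "successively R (u # ws @ [v])" "\<And>y. y \<in> set ws \<Longrightarrow> P y"
  shows "walk R P u v"
  using assms by (induction ws arbitrary: u) (auto intro: walk.intros)

lemma list_of_walk:
  assumes "walk R P u v"
  shows "\<exists>ws. successively R (u # ws @ [v]) \<and> (\<forall>y\<in>set ws. P y)"
  using assms
proof (induction rule: walk.induct)
  case (edge u v)
  then show ?case by (intro exI[of _ "[]"]) simp
next
  case (step u y v)
  then obtain ws where "successively R (y # ws @ [v])" "\<forall>y\<in>set ws. P y" by blast
  with step.hyps show ?case by (intro exI[of _ "y # ws"]) simp
qed

text \<open>Cut out the detour at a repeated vertex and recurse on the length. Interior vertices
  survive only from the old list, so any condition on them is inherited.\<close>

lemma successively_shorten: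
  assumes "successively R (u # ws @ [v])" "u \<noteq> v"
  shows "\<exists>ws'. set ws' \<subseteq> set ws \<and> distinct (u # ws' @ [v]) \<and> successively R (u # ws' @ [v])"
  using assms
proof (induction "length ws" arbitrary: ws rule: less_induct)
  case less
  show ?case
  proof (cases "distinct (u # ws @ [v])")
    case False
    then consider "u \<in> set ws" | "v \<in> set ws" | "\<not> distinct ws" using less.prems by auto
    then obtain ws1 where "length ws1 < length ws" "set ws1 \<subseteq> set ws"
      "successively R (u # ws1 @ [v])"
    proof cases
      case 1
      then obtain a b where "ws = a @ u # b" by (auto simp: in_set_conv_decomp)
      then show ?thesis using less.prems that[of b] by (auto simp: successively_append_iff successively_Cons)
    next
      case 2
      then obtain a b where "ws = a @ v # b" by (auto simp: in_set_conv_decomp)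
      then show ?thesis using less.prems that[of a]
        by (auto simp: successively_append_iff successively_Cons hd_append split: if_splits)
    next
      case 3
      then obtain a x b c where "ws = a @ [x] @ b @ [x] @ c" using not_distinct_decomp by blast
      then show ?thesis using less.prems that[of "a @ x # c"]
        by (auto simp: successively_append_iff successively_Cons hd_append split: if_splits)
    qed
    with less.hyps[of ws1] less.prems show ?thesis by blast
  qed (use less.prems in auto)
qed

lemma successively_iff_nth:
  "successively R xs \<longleftrightarrow> (\<forall>i. Suc i < length xs \<longrightarrow> R (xs ! i) (xs ! Suc i))"
proof (induction xs rule: induct_list012)
  case (3 x y zs)
  show ?case
    unfolding successively.simps(3) 3(2)
    by (auto simp: less_Suc_eq_0_disj nth_Cons split: nat.splits)
qed auto

lemma is_path_Cons_snoc:
  "is_path V E u (u # ws @ [v]) v \<longleftrightarrow> distinct (u # ws @ [v]) \<and> set (u # ws @ [v]) \<subseteq> V \<and>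
     successively (\<lambda>x y. {x, y} \<in> E) (u # ws @ [v])"
  unfolding is_path_def successively_iff_nth by auto

lemma is_path_decomp:
  assumes "is_path V E u xs v" "u \<noteq> v"
  obtains ws where "xs = u # ws @ [v]"
proof -
  obtain ys where ys: "xs = u # ys" using assms by (cases xs) (auto simp: is_path_def)
  then have "ys \<noteq> []" "last ys = v" using assms by (auto simp: is_path_def split: if_splits)
  then have "ys = butlast ys @ [v]" by (metis append_butlast_last_id)
  then show ?thesis using that ys by metis
qed

lemma total_monochromatic_Cons_snoc:
  "total_monochromatic cv ce (u # ws @ [v]) \<longleftrightarrow>
     (\<exists>c. successively (\<lambda>x y. ce {x, y} = c) (u # ws @ [v]) \<and> (\<forall>x\<in>set ws. cv x = c))"
proof -
  have "(\<forall>e\<in>path_edges xs. ce e = c) \<longleftrightarrow> successively (\<lambda>x y. ce {x, y} = c) xs" for c and xs :: "'a list"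
    unfolding path_edges_def successively_iff_nth by blast
  moreover have "internal_vertices (u # ws @ [v]) = set ws" by (simp add: internal_vertices_def)
  ultimately show ?thesis unfolding total_monochromatic_def by simp
qed

lemma successively_conj:
  "successively R xs \<Longrightarrow> successively Q xs \<Longrightarrow> successively (\<lambda>x y. R x y \<and> Q x y) xs"
  by (simp add: successively_iff_nth)

text \<open>An internal vertex of a monochromatic path has two distinct neighbours on it; for ear vertices,
  which have degree two, this determines the colors of all incident edges.\<close>

definition passes :: "'a set set \<Rightarrow> ('a \<Rightarrow> nat) \<Rightarrow> ('a set \<Rightarrow> nat) \<Rightarrow> nat \<Rightarrow> 'a \<Rightarrow> bool" where
  "passes E cv ce c x \<longleftrightarrow> cv x = c \<and>
     (\<exists>p q. p \<noteq> q \<and> {p, x} \<in> E \<and> {x, q} \<in> E \<and> ce {p, x} = c \<and> ce {x, q} = c)"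

text \<open>Distinctness of the path is spent here and kept in \<open>passes\<close>: predecessor
  and successor of an interior vertex differ. Upper bounds then work with walks only.\<close>

lemma TMC_walk:
  assumes "TMC_coloring V E cv ce" "u \<in> V" "v \<in> V" "u \<noteq> v"
  obtains c where "walk (\<lambda>x y. {x, y} \<in> E \<and> ce {x, y} = c) (passes E cv ce c) u v"
proof -
  obtain xs where xs: "is_path V E u xs v" "total_monochromatic cv ce xs"
    using assms unfolding TMC_coloring_def by blast
  then obtain ws where ws: "xs = u # ws @ [v]" using is_path_decomp assms(4) by metis
  obtain c where c: "successively (\<lambda>x y. ce {x, y} = c) (u # ws @ [v])" "\<forall>x\<in>set ws. cv x = c"
    using xs(2) unfolding ws total_monochromatic_Cons_snoc by blast
  have p: "distinct (u # ws @ [v])" "successively (\<lambda>x y. {x, y} \<in> E) (u # ws @ [v])"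
    using xs(1) unfolding ws is_path_Cons_snoc by auto
  have s: "successively (\<lambda>x y. {x, y} \<in> E \<and> ce {x, y} = c) (u # ws @ [v])"
    using successively_conj[OF p(2) c(1)] .
  have "passes E cv ce c x" if x: "x \<in> set ws" for x
  proof -
    obtain as bs where ab: "ws = as @ x # bs" using x by (auto simp: in_set_conv_decomp)
    have l: "u # ws @ [v] = (u # as) @ [x] @ (bs @ [v])" using ab by simp
    have "last (u # as) \<in> set (u # as)" "hd (bs @ [v]) \<in> set (bs @ [v])"
      by (rule last_in_set, simp) (rule hd_in_set, simp)
    then have "last (u # as) \<noteq> hd (bs @ [v])" using p(1) unfolding l distinct_append by auto
    moreover have "{last (u # as), x} \<in> E \<and> ce {last (u # as), x} = c"
      "{x, hd (bs @ [v])} \<in> E \<and> ce {x, hd (bs @ [v])} = c"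
      using s unfolding l by (simp_all only: successively_append_iff) auto
    ultimately show ?thesis using c(2) x unfolding passes_def by blast
  qed
  then show ?thesis using that walk_of_list[OF s] by blast
qed

text \<open>A walk shortens to a path without leaving its color, so repetitions are harmless when a
  coloring is constructed.\<close>

lemma TMC_coloringI:
  assumes E: "E \<subseteq> [V]\<^bsup>2\<^esup>"
    and w: "\<And>u v. u \<in> V \<Longrightarrow> v \<in> V \<Longrightarrow> u \<noteq> v \<Longrightarrow>
      \<exists>c. walk (\<lambda>x y. {x, y} \<in> E \<and> ce {x, y} = c) (\<lambda>x. cv x = c) u v"
  shows "TMC_coloring V E cv ce"
  unfolding TMC_coloring_def
proof (intro ballI impI)
  fix u v assume uv: "u \<in> V" "v \<in> V" "u \<noteq> v"
  then obtain c where "walk (\<lambda>x y. {x, y} \<in> E \<and> ce {x, y} = c) (\<lambda>x. cv x = c) u v" using w by blast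
  then obtain ws where "successively (\<lambda>x y. {x, y} \<in> E \<and> ce {x, y} = c) (u # ws @ [v])"
    "\<forall>y\<in>set ws. cv y = c" using list_of_walk by fast
  then obtain ws where ws: "\<forall>y\<in>set ws. cv y = c" "distinct (u # ws @ [v])"
    "successively (\<lambda>x y. {x, y} \<in> E \<and> ce {x, y} = c) (u # ws @ [v])"
    using successively_shorten[OF _ uv(3)] by (meson subset_iff)
  have sE: "successively (\<lambda>x y. {x, y} \<in> E) (u # ws @ [v])"
    and sc: "successively (\<lambda>x y. ce {x, y} = c) (u # ws @ [v])"
    using ws(3) unfolding successively_iff_nth by blast+
  have "x \<in> V" if x: "x \<in> set ws" for x
  proof -
    obtain as bs where ab: "ws = as @ x # bs" using x by (auto simp: in_set_conv_decomp)
    have l: "u # ws @ [v] = (u # as) @ [x] @ (bs @ [v])" using ab by simp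
    have "{last (u # as), x} \<in> E" using sE unfolding l by (simp only: successively_append_iff) auto
    then show ?thesis using E by (auto simp: nsets_def)
  qed
  then have "is_path V E u (u # ws @ [v]) v"
    unfolding is_path_Cons_snoc using ws sE uv by auto
  moreover have "total_monochromatic cv ce (u # ws @ [v])"
    unfolding total_monochromatic_Cons_snoc using sc ws by blast
  ultimately show "\<exists>xs. is_path V E u xs v \<and> total_monochromatic cv ce xs" by blast
qed

lemma connected_graph_simple: "connected_graph V E \<Longrightarrow> E \<subseteq> [V]\<^bsup>2\<^esup> \<and> finite V"
  by (auto simp: connected_graph_def simple_graph_def)

lemma connected_graph_walk:
  assumes "connected_graph V E" "u \<in> V" "v \<in> V" "u \<noteq> v"
  shows "walk (\<lambda>x y. {x, y} \<in> E) (\<lambda>_. True) u v"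
proof -
  obtain xs where xs: "is_path V E u xs v" using assms unfolding connected_graph_def by blast
  then obtain ws where ws: "xs = u # ws @ [v]" using is_path_decomp assms(4) by metis
  have "successively (\<lambda>x y. {x, y} \<in> E) (u # ws @ [v])"
    using xs unfolding ws is_path_Cons_snoc by auto
  then show ?thesis by (rule walk_of_list) simp
qed

lemma connected_graph_conn:
  assumes "connected_graph V E"
  shows "conn E V"
  unfolding conn_def
proof (intro allI impI)
  fix B assume B: "B \<subset> V" "B \<noteq> {}"
  then obtain u v where uv: "u \<in> B" "v \<in> V" "v \<notin> B" by blast
  have "walk (\<lambda>x y. {x, y} \<in> E) (\<lambda>_. True) u v"
    using uv B by (intro connected_graph_walk[OF assms]) auto
  from walk_cross[OF this uv(1,3)] obtain x y where "x \<in> B" "y \<notin> B" "{x, y} \<in> E" by blast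
  moreover have "y \<in> V" using \<open>{x, y} \<in> E\<close> connected_graph_simple[OF assms] by (auto simp: nsets_def)
  ultimately show "\<exists>x\<in>B. \<exists>y\<in>V - B. {x, y} \<in> E" by blast
qed

lemma conn_connected_graph:
  assumes "E \<subseteq> [V]\<^bsup>2\<^esup>" "finite V" "V \<noteq> {}" "conn E V"
  shows "connected_graph V E"
  unfolding connected_graph_def simple_graph_def
proof (intro conjI ballI assms)
  fix u v assume uv: "u \<in> V" "v \<in> V"
  show "\<exists>xs. is_path V E u xs v"
  proof (cases "u = v")
    case True
    then show ?thesis using uv by (intro exI[of _ "[u]"]) (simp add: is_path_def)
  next
    case False
    let ?W = "walk (\<lambda>x y. {x, y} \<in> E) (\<lambda>_. True) u"
    let ?B = "{x \<in> V. x = u \<or> ?W x}"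
    have "?B = V"
    proof (rule ccontr)
      assume "?B \<noteq> V"
      then have "?B \<subset> V" "?B \<noteq> {}" using uv by auto
      then obtain x y where xy: "x \<in> ?B" "y \<in> V - ?B" "{x, y} \<in> E" by (rule connD[OF assms(4)])
      then have "walk (\<lambda>x y. {x, y} \<in> E) (\<lambda>_. True) x y" by (auto intro: walk.edge)
      then have "?W y" using xy by (auto intro: walk_trans)
      then show False using xy by auto
    qed
    then have "?W v" using uv False by auto
    then obtain ws where "successively (\<lambda>x y. {x, y} \<in> E) (u # ws @ [v])"
      using list_of_walk[OF \<open>?W v\<close>] by blast
    from successively_shorten[OF this False] obtain ws where
      ws: "distinct (u # ws @ [v])" "successively (\<lambda>x y. {x, y} \<in> E) (u # ws @ [v])" by blast
    have "x \<in> V" if x: "x \<in> set ws" for x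
    proof -
      obtain as bs where ab: "ws = as @ x # bs" using x by (auto simp: in_set_conv_decomp)
      have l: "u # ws @ [v] = (u # as) @ [x] @ (bs @ [v])" using ab by simp
      have "{last (u # as), x} \<in> E" using ws(2) unfolding l by (simp only: successively_append_iff) auto
      then show ?thesis using assms(1) by (auto simp: nsets_def)
    qed
    then have "is_path V E u (u # ws @ [v]) v"
      unfolding is_path_Cons_snoc using ws uv by auto
    then show ?thesis by blast
  qed
qed

lemma finite_edges: "E \<subseteq> [V]\<^bsup>2\<^esup> \<Longrightarrow> finite V \<Longrightarrow> finite E"
  using finite_imp_finite_nsets finite_subset by blast

section \<open>Lower and upper bounds for the number of colors\<close>

lemma finite_color_numbers:
  assumes "finite V" "finite E"
  shows "finite {card (cv ` V \<union> ce ` E) | cv ce. TMC_coloring V E cv ce}"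
proof (rule finite_subset)
  show "{card (cv ` V \<union> ce ` E) | cv ce. TMC_coloring V E cv ce} \<subseteq> {..card V + card E}"
  proof clarify
    fix cv :: "'a \<Rightarrow> nat" and ce
    show "card (cv ` V \<union> ce ` E) \<le> card V + card E"
      using card_Un_le[of "cv ` V" "ce ` E"] card_image_le[OF assms(1), of cv]
        card_image_le[OF assms(2), of ce] by linarith
  qed
qed simp

lemma tmc_ge:
  assumes "E \<subseteq> [V]\<^bsup>2\<^esup>" "finite V" "TMC_coloring V E cv ce"
  shows "card (cv ` V \<union> ce ` E) \<le> tmc V E"
  unfolding tmc_def
  using finite_color_numbers[OF assms(2) finite_edges[OF assms(1,2)]] assms(3) by (intro Max_ge) auto

lemma tmc_le:
  assumes G: "connected_graph V E"
    and b: "\<And>cv ce. TMC_coloring V E cv ce \<Longrightarrow> card (cv ` V \<union> ce ` E) \<le> b"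
  shows "tmc V E \<le> b"
proof -
  have E: "E \<subseteq> [V]\<^bsup>2\<^esup>" "finite V" using connected_graph_simple[OF G] by auto
  have "TMC_coloring V E (\<lambda>_. 0) (\<lambda>_. 0)"
    using connected_graph_walk[OF G] by (intro TMC_coloringI E(1) exI[of _ 0]) simp
  then have "{card (cv ` V \<union> ce ` E) | cv ce. TMC_coloring V E cv ce} \<noteq> {}" by blast
  then show ?thesis
    unfolding tmc_def using b finite_color_numbers[OF E(2) finite_edges[OF E]]
    by (subst Max_le_iff) auto
qed

text \<open>Charge \<open>v\<close> to itself or to the first edge of a path of color \<open>w v\<close> leaving it. The charged
  elements \<open>Y\<close> are distinct and every color survives on the rest.\<close>

lemma witness_set:
  fixes cv :: "'a \<Rightarrow> nat"
  assumes "finite W" "W \<subseteq> V"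
    and y: "\<And>v. v \<in> W \<Longrightarrow> {v, y v} \<in> E \<and> ce {v, y v} = w v \<and> y v \<in> V \<and> cv (y v) = w v \<and> y v \<noteq> v"
  defines "Y \<equiv> (\<lambda>v. if cv v = w v then Inl v else Inr {v, y v}) ` W"
  shows "Y \<subseteq> V <+> E" "card Y = card W"
    and "case_sum cv ce ` ((V <+> E) - Y) = cv ` V \<union> ce ` E"
proof -
  let ?g = "\<lambda>v. if cv v = w v then Inl v else Inr {v, y v}"
  let ?col = "case_sum cv ce"
  show sub: "Y \<subseteq> V <+> E" using assms(2) y by (auto simp: Y_def)
  \<comment> \<open>Two vertices charging the same edge would be each other's first step; then
    \<open>cv a = w b = w a\<close>, so \<open>a\<close> would have charged itself.\<close>
  have "inj_on ?g W"
  proof (rule inj_onI)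
    fix a b assume ab: "a \<in> W" "b \<in> W" "?g a = ?g b"
    show "a = b"
    proof (rule ccontr)
      assume "a \<noteq> b"
      then have *: "cv a \<noteq> w a" "y b = a" "y a = b"
        using ab by (auto split: if_splits simp: doubleton_eq_iff)
      have "{a, y a} = {b, y b}" using * by (simp add: insert_commute)
      moreover have "ce {a, y a} = w a" "ce {b, y b} = w b" using y ab by auto
      ultimately have "w a = w b" by simp
      then show False using * y[OF ab(2)] by simp
    qed
  qed
  then show "card Y = card W" unfolding Y_def by (rule card_image)
  have free: "Inr {p, y p} \<notin> Y" if "p \<in> W" "cv p = w p" for p
  proof
    assume "Inr {p, y p} \<in> Y"
    then obtain v where v: "v \<in> W" "cv v \<noteq> w v" "{p, y p} = {v, y v}"
      by (auto simp: Y_def split: if_splits)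
    have "ce {v, y v} = w v" "ce {p, y p} = w p" using y v(1) that(1) by auto
    then have wp: "w p = w v" using v(3) by simp
    from v(3) have "v = p \<or> v = y p" by (auto simp: doubleton_eq_iff)
    then show False using v(2) that wp y[OF that(1)] by auto
  qed
  \<comment> \<open>The color \<open>w v\<close> is found uncharged on the edge
    \<open>{v, y v}\<close> if \<open>v\<close> charges itself; otherwise on the vertex
    \<open>y v\<close> or, if that one charges itself, on its own edge.\<close>
  have colY: "?col ` (V <+> E) \<subseteq> ?col ` ((V <+> E) - Y)"
  proof
    fix c assume "c \<in> ?col ` (V <+> E)"
    then obtain x where x: "x \<in> V <+> E" "c = ?col x" by blast
    show "c \<in> ?col ` ((V <+> E) - Y)"
    proof (cases "x \<in> Y")
      case True
      then obtain v where v: "v \<in> W" "x = ?g v" by (auto simp: Y_def)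
      have c: "c = w v" using x v y[OF v(1)] by auto
      show ?thesis
      proof (cases "cv v = w v")
        case True
        then have "Inr {v, y v} \<in> (V <+> E) - Y" using free[OF v(1)] y[OF v(1)] by auto
        then show ?thesis using c y[OF v(1)] by (metis image_eqI old.sum.simps(6))
      next
        case False
        let ?u = "y v"
        show ?thesis
        proof (cases "Inl ?u \<in> Y")
          case False
          then have "Inl ?u \<in> (V <+> E) - Y" using y[OF v(1)] by auto
          then show ?thesis using c y[OF v(1)] by (metis image_eqI old.sum.simps(5))
        next
          case True
          then have u: "?u \<in> W" "cv ?u = w ?u" by (auto simp: Y_def split: if_splits)
          then have "Inr {?u, y ?u} \<in> (V <+> E) - Y" using free[OF u] y[OF u(1)] by auto
          moreover have "ce {?u, y ?u} = c" using c u y[OF v(1)] y[OF u(1)] by simp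
          ultimately show ?thesis by (metis image_eqI old.sum.simps(6))
        qed
      qed
    qed (use x in auto)
  qed
  have "?col ` (V <+> E) = cv ` V \<union> ce ` E" by (auto simp: Plus_def image_Un image_image)
  then show "?col ` ((V <+> E) - Y) = cv ` V \<union> ce ` E" using colY by blast
qed

text \<open>The path from \<open>v\<close> to its non-neighbour \<open>u\<close> has an interior
  vertex, and the first one shares the color of the edge leading to it. This supplies
  \<open>y\<close> in \<open>witness_set\<close>.\<close>

lemma first_step:
  assumes "TMC_coloring V E cv ce" "E \<subseteq> [V]\<^bsup>2\<^esup>" "u \<in> V" "v \<in> V" "u \<noteq> v" "{u, v} \<notin> E"
  shows "\<exists>y. {v, y} \<in> E \<and> y \<in> V \<and> cv y = ce {v, y} \<and> y \<noteq> v"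
proof -
  obtain c where "walk (\<lambda>x y. {x, y} \<in> E \<and> ce {x, y} = c) (passes E cv ce c) v u"
    using TMC_walk[OF assms(1,4,3)] assms(5) by metis
  then show ?thesis
  proof (cases rule: walk.cases)
    case (step y)
    have "{v, y} \<in> [V]\<^bsup>2\<^esup>" using step assms(2) by blast
    then show ?thesis using step by (intro exI[of _ y]) (auto simp: passes_def)
  qed (use assms(6) in \<open>auto simp: insert_commute\<close>)
qed

text \<open>\<open>witness_set\<close> discards \<open>card W\<close> of the
  \<open>card V + card E\<close> colored elements without losing a color.\<close>

lemma colors_le_nondominating:
  assumes T: "TMC_coloring V E cv ce" and E: "E \<subseteq> [V]\<^bsup>2\<^esup>" "finite V"
    and W: "W \<subseteq> V" "\<And>v. v \<in> W \<Longrightarrow> \<exists>u\<in>V. u \<noteq> v \<and> {u, v} \<notin> E"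
  shows "card (cv ` V \<union> ce ` E) + card W \<le> card V + card E"
proof -
  have "\<forall>v\<in>W. \<exists>y. {v, y} \<in> E \<and> y \<in> V \<and> cv y = ce {v, y} \<and> y \<noteq> v"
    using first_step[OF T E(1)] W by blast
  then obtain y where y0: "\<forall>v\<in>W. {v, y v} \<in> E \<and> y v \<in> V \<and> cv (y v) = ce {v, y v} \<and> y v \<noteq> v"
    by (rule bchoice[THEN exE])
  define w where "w v = ce {v, y v}" for v
  have y: "{v, y v} \<in> E \<and> ce {v, y v} = w v \<and> y v \<in> V \<and> cv (y v) = w v \<and> y v \<noteq> v"
    if "v \<in> W" for v using y0 that by (simp add: w_def)
  have fin: "finite W" "finite E" using W E finite_subset finite_edges by blast+
  let ?X = "V <+> E"
  let ?Y = "(\<lambda>v. if cv v = w v then Inl v else Inr {v, y v}) ` W"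
  note Y = witness_set[where V = V and E = E and cv = cv and ce = ce and y = y and w = w, OF fin(1) W(1) y]
  have X: "finite ?X" "card ?X = card V + card E" using fin E by (auto simp: card_Plus)
  have "card (case_sum cv ce ` (?X - ?Y)) \<le> card (?X - ?Y)"
    using X by (intro card_image_le) auto
  then have "card (cv ` V \<union> ce ` E) \<le> card (?X - ?Y)" using Y(3) by simp
  also have "\<dots> = card ?X - card W" using Y(1,2) fin by (simp add: card_Diff_subset)
  finally have "card (cv ` V \<union> ce ` E) \<le> card ?X - card W" .
  moreover have "card W \<le> card ?X" using card_mono[OF X(1) Y(1)] Y(2) by simp
  ultimately show ?thesis using X by simp
qed

text \<open>\<open>A\<close> and \<open>F\<close> share color 0, all other elements get private
  colors, shifted by \<open>Suc\<close> to avoid 0. Color 0 occurs because \<open>A\<close> is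
  nonempty.\<close>

lemma rainbow_outside:
  assumes "finite V" "finite E" "A \<subseteq> V" "F \<subseteq> E" "A \<noteq> {}"
  obtains cv :: "'a \<Rightarrow> nat" and ce :: "'a set \<Rightarrow> nat" where
    "\<And>x. x \<in> A \<Longrightarrow> cv x = 0" "\<And>e. e \<in> F \<Longrightarrow> ce e = 0"
    "card (cv ` V \<union> ce ` E) + card A + card F = card V + card E + 1"
proof -
  let ?X = "V <+> E" and ?K = "A <+> F"
  have X: "finite ?X" "?K \<subseteq> ?X" using assms by auto
  obtain h :: "'a + 'a set \<Rightarrow> nat" where h: "inj_on h ?X"
    using finite_imp_inj_to_nat_seg[OF X(1)] by blast
  define g where "g x = (if x \<in> ?K then 0 else Suc (h x))" for x
  have "(\<lambda>x. g (Inl x)) ` V \<union> (\<lambda>e. g (Inr e)) ` E = g ` ?X" by (auto simp: Plus_def image_Un image_image)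
  also have "\<dots> = insert 0 ((\<lambda>x. Suc (h x)) ` (?X - ?K))"
  proof -
    have "g ` ?X = g ` ?K \<union> g ` (?X - ?K)" using X(2) by blast
    moreover have "g ` ?K = {0}" using assms(5) by (auto simp: g_def)
    moreover have "g ` (?X - ?K) = (\<lambda>x. Suc (h x)) ` (?X - ?K)" by (auto simp: g_def intro!: image_cong)
    ultimately show ?thesis by simp
  qed
  also have "card \<dots> = card (?X - ?K) + 1"
  proof -
    have "inj_on (\<lambda>x. Suc (h x)) (?X - ?K)" using h by (auto simp: inj_on_def)
    then show ?thesis using X by (subst card_insert_disjoint) (auto simp: card_image)
  qed
  finally have "card ((\<lambda>x. g (Inl x)) ` V \<union> (\<lambda>e. g (Inr e)) ` E) = card ?X - card ?K + 1"
    using X card_Diff_subset[of ?K ?X] finite_subset[OF X(2,1)] by simp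
  moreover have "card ?K \<le> card ?X" using X by (rule card_mono)
  moreover have "card ?X = card V + card E" "card ?K = card A + card F"
    using assms finite_subset[of A V] finite_subset[of F E] by (simp_all add: card_Plus)
  ultimately show ?thesis
    by (intro that[of "\<lambda>x. g (Inl x)" "\<lambda>e. g (Inr e)"]) (auto simp: g_def)
qed

lemma spanning_tree_edges:
  assumes "conn E D" "finite D" "d \<in> D"
  shows "\<exists>F\<subseteq>E. finite F \<and> card F + 1 \<le> card D \<and>
    (\<forall>u\<in>D. u \<noteq> d \<longrightarrow> walk (\<lambda>x y. {x, y} \<in> F) (\<lambda>x. x \<in> D) u d)"
  using assms
proof (induction rule: conn_grow_induct)
  case single
  show ?case by (intro exI[of _ "{}"]) auto
next
  case (grow B x y)
  then obtain F where F: "F \<subseteq> E" "finite F" "card F + 1 \<le> card B"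
    "\<forall>u\<in>B. u \<noteq> d \<longrightarrow> walk (\<lambda>x y. {x, y} \<in> F) (\<lambda>x. x \<in> B) u d" by blast
  let ?F = "insert {x, y} F"
  let ?W = "\<lambda>u. walk (\<lambda>x y. {x, y} \<in> ?F) (\<lambda>x. x \<in> insert y B) u d"
  have old: "?W u" if "u \<in> B" "u \<noteq> d" for u
    using F(4) that by (auto elim!: walk_mono)
  have "?W y"
  proof (cases "x = d")
    case True
    then show ?thesis by (intro walk.edge) (simp add: insert_commute)
  next
    case False
    then show ?thesis using old[of x] grow by (intro walk.step[of _ y x]) (auto simp: insert_commute)
  qed
  moreover have "card ?F + 1 \<le> card (insert y B)"
  proof -
    have "finite B" "y \<notin> B" using grow assms(2) finite_subset by blast+
    then show ?thesis using F card_insert_le_m1[of "card B" F] by (simp add: card_insert_if)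
  qed
  ultimately show ?case using old F grow by (intro exI[of _ ?F]) auto
qed

text \<open>A spanning tree of \<open>D\<close> and one edge per outside vertex make at most
  \<open>card V - 1\<close> edges. Coloring them like \<open>D\<close> connects everything, while
  the outside vertices are leaves and keep private colors.\<close>

lemma tmc_ge_dominating_set:
  assumes E: "E \<subseteq> [V]\<^bsup>2\<^esup>" "finite V" and D: "D \<subseteq> V" "D \<noteq> {}" "conn E D"
    and dom: "\<And>v. v \<in> V - D \<Longrightarrow> \<exists>x\<in>D. {v, x} \<in> E"
  shows "card E + 2 + card (V - D) \<le> tmc V E + card V"
proof -
  have finD: "finite D" using D E finite_subset by blast
  obtain d where d: "d \<in> D" using D by blast
  obtain F where F: "F \<subseteq> E" "finite F" "card F + 1 \<le> card D"
    "\<forall>u\<in>D. u \<noteq> d \<longrightarrow> walk (\<lambda>x y. {x, y} \<in> F) (\<lambda>x. x \<in> D) u d"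
    using spanning_tree_edges[OF D(3) finD d] by blast
  obtain g where g: "\<And>v. v \<in> V - D \<Longrightarrow> g v \<in> D \<and> {v, g v} \<in> E" using dom by metis
  define T where "T = F \<union> (\<lambda>v. {v, g v}) ` (V - D)"
  have T: "T \<subseteq> E" using F g by (auto simp: T_def)
  have "card T \<le> card F + card (V - D)"
    unfolding T_def using E card_Un_le[of F] card_image_le[of "V - D" "\<lambda>v. {v, g v}"]
    by (meson add_left_mono finite_Diff order_trans)
  then have cT: "card T + 1 + card D \<le> card D + card V"
    using F(3) D finD card_mono[OF E(2) D(1)] by (simp add: card_Diff_subset)
  let ?W = "walk (\<lambda>x y. {x, y} \<in> T) (\<lambda>x. x \<in> D)"
  have inD: "?W u d" if "u \<in> D" "u \<noteq> d" for u
    using F(4) that by (auto elim!: walk_mono simp: T_def)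
  have tod: "?W u d" if "u \<in> V" "u \<noteq> d" for u
  proof (cases "u \<in> D")
    case False
    then have u: "{u, g u} \<in> T" "g u \<in> D" using that g by (auto simp: T_def)
    then show ?thesis
    proof (cases "g u = d")
      case True
      then show ?thesis using u by (intro walk.edge) simp
    next
      case False
      then show ?thesis using u inD by (intro walk.step[of _ u "g u"]) auto
    qed
  qed (use inD that in auto)
  have sym: "?W v u" if "?W u v" for u v using that by (rule walk_sym) (simp add: insert_commute)
  obtain cv :: "'a \<Rightarrow> nat" and ce where c: "\<And>x. x \<in> D \<Longrightarrow> cv x = 0" "\<And>e. e \<in> T \<Longrightarrow> ce e = 0"
    "card (cv ` V \<union> ce ` E) + card D + card T = card V + card E + 1"
    using rainbow_outside[OF E(2) finite_edges[OF E] D(1) T D(2)] by blast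
  have "TMC_coloring V E cv ce"
  proof (rule TMC_coloringI[OF E(1)])
    fix u v assume uv: "u \<in> V" "v \<in> V" "u \<noteq> v"
    have "?W u v"
    proof (cases "u = d \<or> v = d")
      case True
      then show ?thesis using tod sym uv by blast
    next
      case False
      then have "?W u d" "?W v d" using uv by (simp_all add: tod)
      then show ?thesis by (rule walk_trans[OF _ d sym])
    qed
    then have "walk (\<lambda>x y. {x, y} \<in> E \<and> ce {x, y} = 0) (\<lambda>x. cv x = 0) u v"
      by (rule walk_mono) (use c T in auto)
    then show "\<exists>c. walk (\<lambda>x y. {x, y} \<in> E \<and> ce {x, y} = c) (\<lambda>x. cv x = c) u v" ..
  qed
  from tmc_ge[OF E this] show ?thesis
    using c(3) cT D finD E card_mono[OF E(2) D(1)] by (simp add: card_Diff_subset)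
qed

text \<open>Fewer than \<open>card V\<close> vertices touch a missing edge, so some \<open>d\<close>
  is adjacent to all others. Only \<open>d\<close> and its edges to touched vertices share a color;
  the touched vertices are ends of two-edge paths and keep theirs.\<close>

lemma tmc_ge_dense:
  assumes E: "E \<subseteq> [V]\<^bsup>2\<^esup>" "finite V" and few: "2 * card ([V]\<^bsup>2\<^esup> - E) < card V"
  shows "card V + card E \<le> tmc V E + 2 * card ([V]\<^bsup>2\<^esup> - E)"
proof -
  let ?H = "[V]\<^bsup>2\<^esup> - E"
  let ?N = "\<Union>?H"
  have finH: "finite ?H" using E finite_imp_finite_nsets by blast
  have "card ?N \<le> (\<Sum>e\<in>?H. card e)" by (rule card_Union_le_sum_card)
  also have "\<dots> = (\<Sum>e\<in>?H. 2)" by (rule sum.cong) (auto simp: nsets_def)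
  finally have N: "card ?N \<le> 2 * card ?H" by simp
  have NV: "?N \<subseteq> V" by (auto simp: nsets_def)
  then have finN: "finite ?N" using E finite_subset by blast
  have "?N \<noteq> V" using N few by auto
  then obtain d where d: "d \<in> V" "d \<notin> ?N" using NV by blast
  have dE: "{d, w} \<in> E" if "w \<in> V" "w \<noteq> d" for w
  proof (rule ccontr)
    assume "{d, w} \<notin> E"
    then have "{d, w} \<in> ?H" using that d by auto
    then show False using d by blast
  qed
  let ?F = "(\<lambda>w. {d, w}) ` ?N"
  have F: "?F \<subseteq> E" using dE d NV by blast
  have cF: "card ?F \<le> 2 * card ?H" using card_image_le[OF finN, of "\<lambda>w. {d, w}"] N by linarith
  obtain cv :: "'a \<Rightarrow> nat" and ce where c: "\<And>x. x \<in> {d} \<Longrightarrow> cv x = 0" "\<And>e. e \<in> ?F \<Longrightarrow> ce e = 0"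
    "card (cv ` V \<union> ce ` E) + card {d} + card ?F = card V + card E + 1"
    using rainbow_outside[OF E(2) finite_edges[OF E] _ F, of "{d}"] d by blast
  have "TMC_coloring V E cv ce"
  proof (rule TMC_coloringI[OF E(1)])
    fix u v assume uv: "u \<in> V" "v \<in> V" "u \<noteq> v"
    show "\<exists>c. walk (\<lambda>x y. {x, y} \<in> E \<and> ce {x, y} = c) (\<lambda>x. cv x = c) u v"
    proof (cases "{u, v} \<in> E")
      case True
      then show ?thesis by (intro exI[of _ "ce {u, v}"] walk.edge) simp
    next
      case False
      then have "{u, v} \<in> ?H" using uv by auto
      then have "u \<in> ?N" "v \<in> ?N" by blast+
      then have "{d, u} \<in> ?F" "{d, v} \<in> ?F" by blast+
      then show ?thesis using c(1,2) F
        by (intro exI[of _ 0] walk.step[of _ u d] walk.edge) (auto simp: insert_commute)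
    qed
  qed
  from tmc_ge[OF E this] show ?thesis using c(3) cF by simp
qed

text \<open>Take \<open>D\<close> maximal. If a vertex \<open>z\<close> were neither in
  \<open>D\<close> nor in its boundary, absorbing a boundary vertex \<open>y\<close> adjacent to
  \<open>z\<close> would trade \<open>y\<close> for \<open>z\<close> in the boundary.\<close>

lemma exists_dominating_conn:
  assumes E: "E \<subseteq> [V]\<^bsup>2\<^esup>" "finite V" "conn E V"
    and D0: "D0 \<subseteq> V" "D0 \<noteq> {}" "conn E D0" "t \<le> card (boundary E V D0)"
  obtains D where "D \<subseteq> V" "D \<noteq> {}" "conn E D" "t \<le> card (V - D)"
    "\<And>v. v \<in> V - D \<Longrightarrow> \<exists>x\<in>D. {v, x} \<in> E"
proof -
  let ?F = "{D. D \<subseteq> V \<and> D \<noteq> {} \<and> conn E D \<and> t \<le> card (boundary E V D)}"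
  have "finite ?F" "D0 \<in> ?F" using E D0 by auto
  then obtain D where D: "D \<in> ?F" and max: "\<And>C. C \<in> ?F \<Longrightarrow> \<not> D \<subset> C"
    by (rule finite_maximal_set) blast
  have all: "D \<union> boundary E V D = V"
  proof (rule ccontr)
    assume "D \<union> boundary E V D \<noteq> V"
    then have "D \<union> boundary E V D \<subset> V" "D \<union> boundary E V D \<noteq> {}"
      using D by (auto simp: boundary_def)
    then obtain y z where yz: "y \<in> D \<union> boundary E V D" "z \<in> V - (D \<union> boundary E V D)" "{y, z} \<in> E"
      by (rule connD[OF E(3)])
    then have y: "y \<in> boundary E V D" by (auto simp: boundary_def)
    then obtain x where x: "x \<in> D" "{x, y} \<in> E" "y \<in> V" "y \<notin> D" by (auto simp: boundary_def)
    have "conn E (insert y D)" using D x by (intro conn_insert[of _ _ x]) auto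
    have fin: "finite (boundary E V D)" "finite (boundary E V (insert y D))"
      using E finite_boundary by blast+
    have "insert z (boundary E V D - {y}) \<subseteq> boundary E V (insert y D)"
      using yz x by (auto simp: boundary_def)
    then have "card (insert z (boundary E V D - {y})) \<le> card (boundary E V (insert y D))"
      using fin by (intro card_mono) auto
    moreover have "card (insert z (boundary E V D - {y})) = card (boundary E V D)"
      using yz fin card_Suc_Diff1[OF fin(1) y] by (subst card_insert_disjoint) auto
    ultimately have "insert y D \<in> ?F" using D x \<open>conn E (insert y D)\<close> by auto
    then show False using max x by blast
  qed
  have "boundary E V D = V - D" using all by (auto simp: boundary_def)
  then show ?thesis using D that[of D] by (auto simp: boundary_def insert_commute)
qed

text \<open>For \<open>l = t - 1\<close> the bound \<open>edge_bound_small_boundary\<close> allows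
  one edge less than assumed. So some connected set has at least \<open>t\<close> boundary vertices,
  and it can be enlarged to a dominating one.\<close>

lemma tmc_ge_sparse:
  assumes E: "E \<subseteq> [V]\<^bsup>2\<^esup>" "finite V" "conn E V" and t: "1 \<le> t" "t + 2 \<le> card V"
    and m: "card V + ((t - 1) choose 2) \<le> card E"
  shows "card E + 2 + t \<le> tmc V E + card V"
proof -
  have "\<exists>D. D \<subseteq> V \<and> D \<noteq> {} \<and> conn E D \<and> \<not> card (boundary E V D) \<le> t - 1"
  proof (rule ccontr)
    assume "\<not> ?thesis"
    then have "2 * card E \<le> 2 * (card V - 1) + (t - 1) * (t - 1 - 1)"
      using t by (intro edge_bound_small_boundary[OF E]) auto
    then show False using m two_choose_two[of "t - 1"] t by linarith
  qed
  then obtain D0 where "D0 \<subseteq> V" "D0 \<noteq> {}" "conn E D0" "t \<le> card (boundary E V D0)"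
    using t(1) that by (metis Suc_diff_le Suc_leI diff_Suc_1 not_le)
  from exists_dominating_conn[OF E this] obtain D where D: "D \<subseteq> V" "D \<noteq> {}" "conn E D" "t \<le> card (V - D)"
    "\<And>v. v \<in> V - D \<Longrightarrow> \<exists>x\<in>D. {v, x} \<in> E" by blast
  show ?thesis using tmc_ge_dominating_set[OF E(1,2) D(1-3,5)] D(4) by linarith
qed

section \<open>Cliques with an ear\<close>

lemma path_edges_simps [simp]:
  "path_edges [] = {}" "path_edges [x] = {}"
  "path_edges (x # y # zs) = insert {x, y} (path_edges (y # zs))"
proof -
  show "path_edges (x # y # zs) = insert {x, y} (path_edges (y # zs))"
    unfolding path_edges_def
  proof (intro equalityI subsetI)
    fix e assume "e \<in> {{(x # y # zs) ! i, (x # y # zs) ! Suc i} |i. Suc i < length (x # y # zs)}"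
    then obtain i where "Suc i < length (x # y # zs)" "e = {(x # y # zs) ! i, (x # y # zs) ! Suc i}" by blast
    then show "e \<in> insert {x, y} {{(y # zs) ! i, (y # zs) ! Suc i} |i. Suc i < length (y # zs)}"
      by (cases i) auto
  next
    fix e assume "e \<in> insert {x, y} {{(y # zs) ! i, (y # zs) ! Suc i} |i. Suc i < length (y # zs)}"
    then consider "e = {x, y}" | i where "Suc i < length (y # zs)" "e = {(y # zs) ! i, (y # zs) ! Suc i}"
      by blast
    then show "e \<in> {{(x # y # zs) ! i, (x # y # zs) ! Suc i} |i. Suc i < length (x # y # zs)}"
    proof cases
      case 1
      then show ?thesis by (intro CollectI exI[of _ 0]) simp
    next
      case 2
      then show ?thesis by (intro CollectI exI[of _ "Suc i"]) simp
    qed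
  qed
qed (auto simp: path_edges_def)

lemma path_edges_append: "path_edges (as @ x # bs) = path_edges (as @ [x]) \<union> path_edges (x # bs)"
proof (induction as)
  case (Cons a as)
  then show ?case by (cases as) auto
qed simp

lemma path_edges_subset: "e \<in> path_edges xs \<Longrightarrow> e \<subseteq> set xs"
  by (induction xs rule: induct_list012) auto

lemma path_edges_nsets: "distinct xs \<Longrightarrow> path_edges xs \<subseteq> [set xs]\<^bsup>2\<^esup>"
proof (induction xs rule: induct_list012)
  case (3 x y zs)
  have "[set (y # zs)]\<^bsup>2\<^esup> \<subseteq> [set (x # y # zs)]\<^bsup>2\<^esup>" by (rule nsets_mono) auto
  then show ?case using 3 by auto
qed auto

lemma finite_path_edges [simp]: "finite (path_edges xs)"
  by (induction xs rule: induct_list012) auto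

lemma card_path_edges: "distinct xs \<Longrightarrow> card (path_edges xs) = length xs - 1"
proof (induction xs rule: induct_list012)
  case (3 x y zs)
  have "{x, y} \<notin> path_edges (y # zs)" using path_edges_subset[of "{x, y}" "y # zs"] 3 by auto
  then show ?case using 3 by simp
qed auto

text \<open>The extremal graphs of the sparse range: a clique \<open>C\<close>, and a further vertex \<open>b\<close> joined to \<open>D\<close> and,
  through the internal vertices \<open>xs\<close> of an ear, to \<open>a\<close>.\<close>

definition ear_edges :: "'a set \<Rightarrow> 'a set \<Rightarrow> 'a \<Rightarrow> 'a \<Rightarrow> 'a list \<Rightarrow> 'a set set" where
  "ear_edges C D a b xs = [C]\<^bsup>2\<^esup> \<union> (\<lambda>x. {b, x}) ` D \<union> path_edges (a # xs @ [b])"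

definition ear_vertices :: "'a set \<Rightarrow> 'a \<Rightarrow> 'a list \<Rightarrow> 'a set" where
  "ear_vertices C b xs = insert b (C \<union> set xs)"

text \<open>As \<open>D\<close> avoids \<open>a\<close> and \<open>xs\<close> is nonempty,
  \<open>a\<close> and \<open>b\<close> are not adjacent; with \<open>2 \<le> card C\<close> every
  vertex has a non-neighbour.\<close>

definition ear :: "'a set \<Rightarrow> 'a set \<Rightarrow> 'a \<Rightarrow> 'a \<Rightarrow> 'a list \<Rightarrow> bool" where
  "ear C D a b xs \<longleftrightarrow> finite C \<and> 2 \<le> card C \<and> a \<in> C \<and> D \<subseteq> C - {a} \<and> b \<notin> C \<and>
     distinct xs \<and> set xs \<inter> insert b C = {} \<and> xs \<noteq> []"

lemma ear_distinct: "ear C D a b xs \<Longrightarrow> distinct (a # xs @ [b])"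
  by (auto simp: ear_def)

lemma ear_edges_nsets:
  assumes "ear C D a b xs"
  shows "ear_edges C D a b xs \<subseteq> [ear_vertices C b xs]\<^bsup>2\<^esup>"
proof -
  have "[C]\<^bsup>2\<^esup> \<subseteq> [ear_vertices C b xs]\<^bsup>2\<^esup>"
    "[set (a # xs @ [b])]\<^bsup>2\<^esup> \<subseteq> [ear_vertices C b xs]\<^bsup>2\<^esup>"
    using assms by (intro nsets_mono; auto simp: ear_def ear_vertices_def)+
  moreover have "(\<lambda>x. {b, x}) ` D \<subseteq> [ear_vertices C b xs]\<^bsup>2\<^esup>"
    using assms by (auto simp: ear_def ear_vertices_def)
  ultimately show ?thesis
    unfolding ear_edges_def using path_edges_nsets[OF ear_distinct[OF assms]] by blast
qed

lemma finite_ear: "ear C D a b xs \<Longrightarrow> finite (ear_vertices C b xs) \<and> finite D"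
  by (auto simp: ear_def ear_vertices_def intro: finite_subset)

lemma card_ear_edges:
  assumes e: "ear C D a b xs"
  shows "card (ear_edges C D a b xs) = (card C choose 2) + card D + length xs + 1"
proof -
  have fin: "finite C" "finite D" using e finite_ear[OF e] by (auto simp: ear_def)
  have bC: "b \<notin> C" using e by (simp add: ear_def)
  have ab: "a \<noteq> b" using e by (auto simp: ear_def)
  have 1: "card ((\<lambda>x. {b, x}) ` D) = card D"
    by (rule card_image) (auto simp: inj_on_def doubleton_eq_iff)
  have d1: "[C]\<^bsup>2\<^esup> \<inter> (\<lambda>x. {b, x}) ` D = {}" using bC by (auto simp: nsets_def)
  have "f \<notin> [C]\<^bsup>2\<^esup> \<union> (\<lambda>x. {b, x}) ` D" if f: "f \<in> path_edges (a # xs @ [b])" for f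
  proof
    assume 2: "f \<in> [C]\<^bsup>2\<^esup> \<union> (\<lambda>x. {b, x}) ` D"
    \<comment> \<open>Every edge of the path has an end among \<open>xs\<close>, whereas clique and
      star edges lie in \<open>insert b C\<close>.\<close>
    have "f \<inter> set xs \<noteq> {}"
    proof -
      obtain x ys where xs: "xs = x # ys" using e by (cases xs) (auto simp: ear_def)
      obtain y zs where xs': "xs = zs @ [y]" using e by (cases xs rule: rev_cases) (auto simp: ear_def)
      have "x \<in> set xs" using xs by simp
      have "y \<in> set xs" using xs' by simp
      have "path_edges (a # xs @ [b]) = insert {a, x} (insert {y, b} (path_edges xs))"
      proof -
        have "path_edges (a # xs @ [b]) = insert {a, x} (path_edges (xs @ [b]))" using xs by simp
        also have "path_edges (xs @ [b]) = insert {y, b} (path_edges xs)"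
          using path_edges_append[of zs y "[b]"] xs' by simp
        finally show ?thesis .
      qed
      then consider "f = {a, x}" | "f = {y, b}" | "f \<in> path_edges xs" using f by blast
      then show ?thesis
      proof cases
        case 3
        have "f \<in> [set xs]\<^bsup>2\<^esup>" using path_edges_nsets[of xs] 3 e by (auto simp: ear_def)
        then have "f \<subseteq> set xs" "f \<noteq> {}" by (auto simp: nsets_def)
        then show ?thesis by blast
      qed (use \<open>x \<in> set xs\<close> \<open>y \<in> set xs\<close> in auto)
    qed
    moreover have "f \<subseteq> insert b C" using 2 e by (auto simp: nsets_def ear_def)
    ultimately show False using e by (auto simp: ear_def)
  qed
  then have d2: "([C]\<^bsup>2\<^esup> \<union> (\<lambda>x. {b, x}) ` D) \<inter> path_edges (a # xs @ [b]) = {}" by blast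
  show ?thesis
    unfolding ear_edges_def using fin d1 d2 1 card_path_edges[OF ear_distinct[OF e]]
    by (simp add: card_Un_disjoint finite_imp_finite_nsets)
qed

lemma conn_Un:
  assumes "conn E A" "conn E B" "z \<in> A" "z \<in> B"
  shows "conn E (A \<union> B)"
proof (rule connI_root)
  fix X assume X: "X \<subset> A \<union> B" "z \<in> X"
  then consider "X \<inter> A \<subset> A" | "X \<inter> B \<subset> B" by blast
  then show "\<exists>x\<in>X. \<exists>y\<in>A \<union> B - X. {x, y} \<in> E"
  proof cases
    case 1
    have "X \<inter> A \<noteq> {}" using X assms by auto
    from connD[OF assms(1) 1 this] show ?thesis by blast
  next
    case 2
    have "X \<inter> B \<noteq> {}" using X assms by auto
    from connD[OF assms(2) 2 this] show ?thesis by blast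
  qed
qed (use assms in auto)

lemma conn_mono: "conn E A \<Longrightarrow> E \<subseteq> F \<Longrightarrow> conn F A"
  unfolding conn_def by blast

lemma conn_path: "conn (path_edges xs) (set xs)"
proof (induction xs rule: induct_list012)
  case (3 x y zs)
  have "conn (path_edges (x # y # zs)) (set (y # zs))"
    using 3(2) by (rule conn_mono) auto
  then have "conn (path_edges (x # y # zs)) (insert x (set (y # zs)))"
    by (rule conn_insert[of _ _ y]) (auto simp: insert_commute)
  then show ?case by simp
qed (auto simp: conn_def)

lemma conn_clique: "conn ([C]\<^bsup>2\<^esup>) C"
  unfolding conn_def
proof (intro allI impI)
  fix B assume "B \<subset> C" "B \<noteq> {}"
  then obtain x y where "x \<in> B" "y \<in> C - B" "x \<in> C" by blast
  then show "\<exists>x\<in>B. \<exists>y\<in>C - B. {x, y} \<in> [C]\<^bsup>2\<^esup>"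
    by (intro bexI[of _ x] bexI[of _ y]) auto
qed

lemma ear_connected:
  assumes e: "ear C D a b xs"
  shows "connected_graph (ear_vertices C b xs) (ear_edges C D a b xs)"
proof (rule conn_connected_graph[OF ear_edges_nsets[OF e]])
  have "conn (ear_edges C D a b xs) (C \<union> set (a # xs @ [b]))"
  proof (rule conn_Un)
    show "conn (ear_edges C D a b xs) C" by (rule conn_mono[OF conn_clique]) (auto simp: ear_edges_def)
    show "conn (ear_edges C D a b xs) (set (a # xs @ [b]))"
      by (rule conn_mono[OF conn_path]) (auto simp: ear_edges_def)
  qed (use e in \<open>auto simp: ear_def\<close>)
  moreover have "C \<union> set (a # xs @ [b]) = ear_vertices C b xs"
    using e by (auto simp: ear_def ear_vertices_def)
  ultimately show "conn (ear_edges C D a b xs) (ear_vertices C b xs)" by simp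
qed (use finite_ear[OF e] in \<open>auto simp: ear_vertices_def\<close>)

section \<open>Contraction of ears and their color bound\<close>

lemma list_neighbours:
  obtains as p q bs where "a # ys = as @ [p]" "zs @ [b] = q # bs"
proof -
  have "a # ys = butlast (a # ys) @ [last (a # ys)]" "zs @ [b] = hd (zs @ [b]) # tl (zs @ [b])" by simp_all
  then show ?thesis by (rule that)
qed

text \<open>Local structure at the ear vertex \<open>x\<close> with neighbours \<open>p\<close> and
  \<open>q\<close>: contraction trades its two edges for \<open>{p, q}\<close>. As this pair is not
  already an edge, it can be colored freely.\<close>

lemma ear_split:
  assumes e: "ear C D a b (ys @ x # zs)" and as: "a # ys = as @ [p]" and bs: "zs @ [b] = q # bs"
  shows "p \<noteq> x" "q \<noteq> x" "p \<noteq> q"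
    and "ear_edges C D a b (ys @ x # zs) = insert {p, x} (insert {x, q}
      ([C]\<^bsup>2\<^esup> \<union> (\<lambda>x. {b, x}) ` D \<union> path_edges (as @ [p]) \<union> path_edges (q # bs)))"
    and "{x, y} \<in> ear_edges C D a b (ys @ x # zs) \<longleftrightarrow> y = p \<or> y = q"
    and "ear_edges C D a b (ys @ zs) = insert {p, q}
      ([C]\<^bsup>2\<^esup> \<union> (\<lambda>x. {b, x}) ` D \<union> path_edges (as @ [p]) \<union> path_edges (q # bs))"
    and "{p, q} \<notin> ear_edges C D a b (ys @ x # zs)"
proof -
  let ?K = "[C]\<^bsup>2\<^esup> \<union> (\<lambda>x. {b, x}) ` D"
  have list: "a # (ys @ x # zs) @ [b] = as @ p # x # q # bs" "a # (ys @ zs) @ [b] = as @ p # q # bs"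
  proof -
    have "a # (ys @ x # zs) @ [b] = (a # ys) @ x # zs @ [b]" by simp
    then show "a # (ys @ x # zs) @ [b] = as @ p # x # q # bs" unfolding as bs by simp
    have "a # (ys @ zs) @ [b] = (a # ys) @ zs @ [b]" by simp
    then show "a # (ys @ zs) @ [b] = as @ p # q # bs" unfolding as bs by simp
  qed
  have dist: "distinct (as @ p # x # q # bs)" using ear_distinct[OF e] unfolding list .
  have E: "ear_edges C D a b (ys @ x # zs) = insert {p, x} (insert {x, q}
      (?K \<union> path_edges (as @ [p]) \<union> path_edges (q # bs)))"
    unfolding ear_edges_def list using path_edges_append[of as p "x # q # bs"] by auto
  have E': "ear_edges C D a b (ys @ zs) = insert {p, q} (?K \<union> path_edges (as @ [p]) \<union> path_edges (q # bs))"
    unfolding ear_edges_def list using path_edges_append[of as p "q # bs"] by auto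
  have xC: "x \<notin> insert b C" "D \<subseteq> C - {a}" using e by (auto simp: ear_def)
  have pe: "f \<subseteq> set (as @ [p])" if "f \<in> path_edges (as @ [p])" for f
    using path_edges_subset[OF that] .
  have qe: "f \<subseteq> set (q # bs)" if "f \<in> path_edges (q # bs)" for f
    using path_edges_subset[OF that] .
  have nb: "y = p \<or> y = q" if y: "{x, y} \<in> ear_edges C D a b (ys @ x # zs)" for y
  proof -
    have "{x, y} \<notin> ?K" using xC by (auto simp: nsets_def doubleton_eq_iff)
    moreover have "{x, y} \<notin> path_edges (as @ [p])" using pe dist by fastforce
    moreover have "{x, y} \<notin> path_edges (q # bs)" using qe dist by fastforce
    ultimately show ?thesis using y unfolding E by (auto simp: doubleton_eq_iff)
  qed
  have "p \<in> set (a # ys)" unfolding as by simp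
  moreover have "q \<in> set (zs @ [b])" unfolding bs by simp
  ultimately have pq: "p = a \<or> p \<in> set ys" "q = b \<or> q \<in> set zs" by auto
  have "{p, q} \<notin> ?K"
    using pq e by (auto simp: ear_def nsets_def doubleton_eq_iff)
  moreover have "{p, q} \<notin> path_edges (as @ [p])" using pe dist by fastforce
  moreover have "{p, q} \<notin> path_edges (q # bs)" using qe dist by fastforce
  moreover have "{p, q} \<noteq> {p, x}" "{p, q} \<noteq> {x, q}" using dist by (auto simp: doubleton_eq_iff)
  ultimately show "{p, q} \<notin> ear_edges C D a b (ys @ x # zs)" unfolding E by blast
  have "{x, p} \<in> ear_edges C D a b (ys @ x # zs)" "{x, q} \<in> ear_edges C D a b (ys @ x # zs)"
    unfolding E by (auto simp: insert_commute)
  then show "{x, y} \<in> ear_edges C D a b (ys @ x # zs) \<longleftrightarrow> y = p \<or> y = q"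
    using nb[of y] by blast
  show "p \<noteq> x" "q \<noteq> x" "p \<noteq> q" using dist by auto
  show "ear_edges C D a b (ys @ x # zs) = insert {p, x} (insert {x, q}
      (?K \<union> path_edges (as @ [p]) \<union> path_edges (q # bs)))" by (fact E)
  show "ear_edges C D a b (ys @ zs) = insert {p, q} (?K \<union> path_edges (as @ [p]) \<union> path_edges (q # bs))"
    by (fact E')
qed

text \<open>Contracting an edge at an ear vertex \<open>x\<close> keeps all colors once \<open>x\<close> and its two edges share a color,
  because the new edge can take that color.\<close>

lemma ear_contract:
  assumes e: "ear C D a b (ys @ x # zs)"
    and T: "TMC_coloring (ear_vertices C b (ys @ x # zs)) (ear_edges C D a b (ys @ x # zs)) cv ce"
    and x: "passes (ear_edges C D a b (ys @ x # zs)) cv ce c x" and ne: "ys @ zs \<noteq> []"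
  shows "ear C D a b (ys @ zs)"
    and "\<exists>ce'. TMC_coloring (ear_vertices C b (ys @ zs)) (ear_edges C D a b (ys @ zs)) cv ce' \<and>
      cv ` ear_vertices C b (ys @ x # zs) \<union> ce ` ear_edges C D a b (ys @ x # zs) \<subseteq>
      cv ` ear_vertices C b (ys @ zs) \<union> ce' ` ear_edges C D a b (ys @ zs)"
proof -
  show e': "ear C D a b (ys @ zs)" using e ne by (auto simp: ear_def)
  let ?V = "ear_vertices C b (ys @ x # zs)" and ?E = "ear_edges C D a b (ys @ x # zs)"
  let ?V' = "ear_vertices C b (ys @ zs)" and ?E' = "ear_edges C D a b (ys @ zs)"
  obtain as p q bs where "a # ys = as @ [p]" "zs @ [b] = q # bs" by (rule list_neighbours)
  note split = ear_split[OF e this]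
  note s = split(1-3) and E = split(4) and nb = split(5) and E' = split(6) and pq = split(7)
  from x obtain p' q' where "p' \<noteq> q'" "{p', x} \<in> ?E" "{x, q'} \<in> ?E" "ce {p', x} = c" "ce {x, q'} = c"
    "cv x = c"
    unfolding passes_def by (elim conjE exE)
  have cx: "cv x = c" "ce {x, p} = c" "ce {x, q} = c"
  proof -
    have "ce {x, p'} = c" "{x, p'} \<in> ?E" using \<open>ce {p', x} = c\<close> \<open>{p', x} \<in> ?E\<close> by (metis insert_commute)+
    then show "cv x = c" "ce {x, p} = c" "ce {x, q} = c"
      using nb[of p'] nb[of q'] \<open>p' \<noteq> q'\<close> \<open>{x, q'} \<in> ?E\<close> \<open>ce {x, q'} = c\<close> \<open>cv x = c\<close> by blast+
  qed
  define ce' where "ce' = ce({p, q} := c)"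
  have keep: "f \<in> ?E' \<and> ce' f = ce f" if "f \<in> ?E" "x \<notin> f" for f
  proof -
    have "f \<noteq> {p, x}" "f \<noteq> {x, q}" using that(2) by auto
    then have "f \<in> ?E'" using that(1) unfolding E E' by blast
    moreover have "f \<noteq> {p, q}" using that(1) pq by metis
    ultimately show ?thesis by (simp add: ce'_def)
  qed
  have new: "{p, q} \<in> ?E'" "ce' {p, q} = c" by (auto simp: E' ce'_def)
  have VV: "?V = insert x ?V'" "x \<notin> ?V'" using e by (auto simp: ear_vertices_def ear_def)
  have "TMC_coloring ?V' ?E' cv ce'"
  proof (rule TMC_coloringI[OF ear_edges_nsets[OF e']])
    fix u v assume uv: "u \<in> ?V'" "v \<in> ?V'" "u \<noteq> v"
    then have "u \<in> ?V" "v \<in> ?V" "u \<noteq> x" "v \<noteq> x" using VV by auto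
    obtain k where w: "walk (\<lambda>x y. {x, y} \<in> ?E \<and> ce {x, y} = k) (passes ?E cv ce k) u v"
      using TMC_walk[OF T \<open>u \<in> ?V\<close> \<open>v \<in> ?V\<close> uv(3)] by blast
    let ?R = "\<lambda>x y. {x, y} \<in> ?E' \<and> ce' {x, y} = k"
    let ?P = "\<lambda>x. cv x = k"
    let ?W = "walk ?R ?P"
    have keepR: "?R y z" if "{y, z} \<in> ?E \<and> ce {y, z} = k" "y \<noteq> x" "z \<noteq> x" for y z
      using keep[of "{y, z}"] that by auto
    have jump: "?R y z" if "y = p \<and> z = q \<or> y = q \<and> z = p" "k = c" for y z
      using that new by (auto simp: insert_commute)
    \<comment> \<open>The induction needs a clause for walks starting at the removed
      \<open>x\<close>: such a walk has color \<open>c\<close> and is resumed at \<open>p\<close> or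
      \<open>q\<close>. Crossing \<open>x\<close> becomes the edge \<open>{p, q}\<close>; turning
      back at \<open>x\<close> becomes staying in place.\<close>
    from w \<open>v \<noteq> x\<close> have "(u \<noteq> x \<longrightarrow> u = v \<or> ?W u v) \<and>
        (u = x \<longrightarrow> (\<exists>z. (z = p \<or> z = q) \<and> k = c \<and> (z = v \<or> ?P z \<and> ?W z v)))"
    proof (induction rule: walk.induct)
      case (edge u v)
      show ?case
      proof (cases "u = x")
        case True
        then have "v = p \<or> v = q" using edge nb by auto
        then show ?thesis using True edge cx by auto
      next
        case False
        then have "?R u v" using keepR edge by auto
        then show ?thesis using False by (auto intro: walk.edge)
      qed
    next
      case (step u y v)
      have Py: "?P y" using step by (simp add: passes_def)
      show ?case
      proof (cases "u = x")
        case True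
        then have y: "y = p \<or> y = q" "k = c" using step nb[of y] cx by auto
        then have "y \<noteq> x" using s by auto
        then show ?thesis using True step y Py by auto
      next
        case False
        show ?thesis
        proof (cases "y = x")
          case True
          then have "u = p \<or> u = q" using step nb[of u] by (auto simp: insert_commute)
          moreover obtain z where z: "z = p \<or> z = q" "k = c" "z = v \<or> ?P z \<and> ?W z v"
            using step True by blast
          ultimately consider "z = u" | "?R u z" using jump[of u z] by blast
          then show ?thesis
          proof cases
            case 1
            then show ?thesis using z False by auto
          next
            case 2
            then show ?thesis using z False walk.edge[of ?R u z ?P] walk.step[of ?R u z ?P v] by auto
          qed
        next
          case F: False
          then have "?R u y" using keepR step False by auto
          moreover have "y = v \<or> ?W y v" using step F by auto
          ultimately show ?thesis using False Py walk.edge[of ?R u y ?P] walk.step[of ?R u y ?P v] by auto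
        qed
      qed
    qed
    then have "?W u v" using \<open>u \<noteq> x\<close> uv(3) by auto
    then show "\<exists>k. walk (\<lambda>x y. {x, y} \<in> ?E' \<and> ce' {x, y} = k) (\<lambda>x. cv x = k) u v" ..
  qed
  moreover have "cv ` ?V \<union> ce ` ?E \<subseteq> cv ` ?V' \<union> ce' ` ?E'"
  proof -
    have c: "c \<in> ce' ` ?E'" using new by (metis image_eqI)
    have "ce f \<in> ce' ` ?E'" if f: "f \<in> ?E" for f
    proof (cases "x \<in> f")
      case True
      then obtain y where "f = {x, y}"
        using f ear_edges_nsets[OF e] by (auto simp: nsets_def card_2_iff)
      then have "ce f = c" using f nb[of y] cx by auto
      then show ?thesis using c by simp
    next
      case False
      then show ?thesis using keep[OF f] by (metis image_eqI)
    qed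
    then show ?thesis using VV c cx by auto
  qed
  ultimately show "\<exists>ce'. TMC_coloring ?V' ?E' cv ce' \<and>
      cv ` ?V \<union> ce ` ?E \<subseteq> cv ` ?V' \<union> ce' ` ?E'" by blast
qed

lemma card_image_less:
  assumes "finite A" "x \<in> A" "y \<in> A" "x \<noteq> y" "f x = f y"
  shows "card (f ` A) < card A"
proof -
  have "card (f ` A) \<noteq> card A" using eq_card_imp_inj_on[OF assms(1)] assms(2-) by (auto dest: inj_onD)
  then show ?thesis using card_image_le[OF assms(1), of f] by simp
qed

text \<open>Charging all vertices leaves at most \<open>card E\<close> colors, one more than
  claimed. Since neither ear vertex is crossed, \<open>x1\<close> must reach \<open>b\<close> via
  \<open>a\<close>, and \<open>x2\<close> must reach \<open>a\<close> via \<open>b\<close>; the two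
  forced connections of \<open>a\<close> and \<open>b\<close> supply a further coincidence.\<close>

lemma ear_colors_two:
  assumes e: "ear C D a b [x1, x2]"
    and T: "TMC_coloring (ear_vertices C b [x1, x2]) (ear_edges C D a b [x1, x2]) cv ce"
    and bad: "\<And>x c. x \<in> {x1, x2} \<Longrightarrow> \<not> passes (ear_edges C D a b [x1, x2]) cv ce c x"
  shows "card (cv ` ear_vertices C b [x1, x2] \<union> ce ` ear_edges C D a b [x1, x2])
    \<le> (card C choose 2) + card D + 2"
proof -
  let ?V = "ear_vertices C b [x1, x2]" and ?E = "ear_edges C D a b [x1, x2]"
  have E: "?E \<subseteq> [?V]\<^bsup>2\<^esup>" using ear_edges_nsets[OF e] .
  have Eeq: "?E = [C]\<^bsup>2\<^esup> \<union> (\<lambda>x. {b, x}) ` D \<union> {{a, x1}, {x1, x2}, {x2, b}}"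
    by (simp add: ear_edges_def)
  have fin: "finite ?V" "finite ?E" using finite_ear[OF e] finite_edges[OF E] by auto
  have d: "a \<noteq> b" "x1 \<noteq> x2" "x1 \<notin> insert b C" "x2 \<notin> insert b C" "a \<in> C" "b \<notin> C" "D \<subseteq> C - {a}"
    using e by (auto simp: ear_def)
  have V: "a \<in> ?V" "b \<in> ?V" "x1 \<in> ?V" "x2 \<in> ?V" using d by (auto simp: ear_vertices_def)
  have inV: "y \<in> ?V \<and> y \<noteq> z" if "{y, z} \<in> ?E" for y z
    using subsetD[OF E that] by simp
  have n1: "y = a \<or> y = x2" if "{x1, y} \<in> ?E" for y
    using that d unfolding Eeq by (auto simp: doubleton_eq_iff nsets_def)
  have n2: "y = x1 \<or> y = b" if "{x2, y} \<in> ?E" for y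
    using that d unfolding Eeq by (auto simp: doubleton_eq_iff nsets_def)
  have nab: "{a, b} \<notin> ?E"
    using d unfolding Eeq by (auto simp: doubleton_eq_iff nsets_def)
  have "x1 \<noteq> b" "x2 \<noteq> a" using d by auto
  \<comment> \<open>\<open>\<alpha>\<close> is the color in which \<open>x1\<close> reaches
    \<open>b\<close>. Having to pass \<open>a\<close>, the walk forces this color on
    \<open>a\<close> and continues from \<open>a\<close> to \<open>b\<close>.\<close>
  obtain \<alpha> where "walk (\<lambda>x y. {x, y} \<in> ?E \<and> ce {x, y} = \<alpha>) (passes ?E cv ce \<alpha>) x1 b"
    using TMC_walk[OF T V(3,2) \<open>x1 \<noteq> b\<close>] by blast
  then have "{x1, a} \<in> ?E \<and> ce {x1, a} = \<alpha> \<and> cv a = \<alpha> \<and>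
    walk (\<lambda>x y. {x, y} \<in> ?E \<and> ce {x, y} = \<alpha>) (passes ?E cv ce \<alpha>) a b"
  proof (cases rule: walk.cases)
    case edge
    then show ?thesis using n1[of b] d by auto
  next
    case (step y)
    then have "y = a" using n1[of y] bad by auto
    then show ?thesis using step by (auto simp: passes_def)
  qed
  then have \<alpha>: "{x1, a} \<in> ?E" "ce {x1, a} = \<alpha>" "cv a = \<alpha>"
    "walk (\<lambda>x y. {x, y} \<in> ?E \<and> ce {x, y} = \<alpha>) (passes ?E cv ce \<alpha>) a b" by blast+
  from \<alpha>(4) obtain y2 where y2: "{a, y2} \<in> ?E" "ce {a, y2} = \<alpha>" "cv y2 = \<alpha>"
    by (cases rule: walk.cases) (use nab in \<open>auto simp: passes_def\<close>)
  obtain z where z: "{z, b} \<in> ?E" "ce {z, b} = \<alpha>" "cv z = \<alpha>"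
    using walk_last[OF \<alpha>(4)] nab by (auto simp: passes_def)
  obtain \<beta> where "walk (\<lambda>x y. {x, y} \<in> ?E \<and> ce {x, y} = \<beta>) (passes ?E cv ce \<beta>) x2 a"
    using TMC_walk[OF T V(4,1) \<open>x2 \<noteq> a\<close>] by blast
  then have "{x2, b} \<in> ?E \<and> ce {x2, b} = \<beta> \<and> cv b = \<beta> \<and>
    walk (\<lambda>x y. {x, y} \<in> ?E \<and> ce {x, y} = \<beta>) (passes ?E cv ce \<beta>) b a"
  proof (cases rule: walk.cases)
    case edge
    then show ?thesis using n2[of a] d by auto
  next
    case (step y)
    then have "y = b" using n2[of y] bad by auto
    then show ?thesis using step by (auto simp: passes_def)
  qed
  then have \<beta>: "{x2, b} \<in> ?E" "ce {x2, b} = \<beta>" "cv b = \<beta>"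
    "walk (\<lambda>x y. {x, y} \<in> ?E \<and> ce {x, y} = \<beta>) (passes ?E cv ce \<beta>) b a" by blast+
  obtain z' where z': "{z', a} \<in> ?E" "ce {z', a} = \<beta>" "cv z' = \<beta>"
    using walk_last[OF \<beta>(4)] nab by (auto simp: passes_def insert_commute)
  \<comment> \<open>\<open>a\<close> is charged in color \<open>\<beta>\<close>, through the last
    edge of the walk from \<open>b\<close>, so that the vertex \<open>a\<close> stays uncharged when
    \<open>\<alpha> \<noteq> \<beta>\<close>.\<close>
  have "\<forall>v\<in>?V. \<exists>y. {v, y} \<in> ?E \<and> y \<in> ?V \<and> cv y = ce {v, y} \<and> y \<noteq> v \<and>
    (v = a \<longrightarrow> ce {v, y} = \<beta>)"
  proof
    fix v assume v: "v \<in> ?V"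
    show "\<exists>y. {v, y} \<in> ?E \<and> y \<in> ?V \<and> cv y = ce {v, y} \<and> y \<noteq> v \<and> (v = a \<longrightarrow> ce {v, y} = \<beta>)"
    proof (cases "v = a")
      case True
      then show ?thesis using z' inV[of z' a] by (intro exI[of _ z']) (auto simp: insert_commute)
    next
      case False
      have "\<exists>u\<in>?V. u \<noteq> v \<and> {u, v} \<notin> ?E"
      proof (cases "v \<in> C")
        case True
        then have "{v, x1} \<notin> ?E" using n1[of v] False d by (auto simp: insert_commute)
        then show ?thesis using V d True by (intro bexI[of _ x1]) (auto simp: insert_commute)
      next
        case notC: False
        then consider "v = b" | "v = x1" | "v = x2" using v by (auto simp: ear_vertices_def)
        then show ?thesis
        proof cases
          case 1
          then show ?thesis using nab d V by (intro bexI[of _ a]) auto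
        next
          case 2
          then show ?thesis using n1[of b] d V by (intro bexI[of _ b]) (auto simp: insert_commute)
        next
          case 3
          then show ?thesis using n2[of a] d V by (intro bexI[of _ a]) (auto simp: insert_commute)
        qed
      qed
      then obtain u where u: "u \<in> ?V" "u \<noteq> v" "{u, v} \<notin> ?E" by blast
      from first_step[OF T E u(1) v u(2,3)] show ?thesis using False by blast
    qed
  qed
  then obtain y where y0: "\<forall>v\<in>?V. {v, y v} \<in> ?E \<and> y v \<in> ?V \<and> cv (y v) = ce {v, y v} \<and> y v \<noteq> v \<and>
    (v = a \<longrightarrow> ce {v, y v} = \<beta>)"
    by (rule bchoice[THEN exE])
  define w where "w v = ce {v, y v}" for v
  have y: "{v, y v} \<in> ?E \<and> ce {v, y v} = w v \<and> y v \<in> ?V \<and> cv (y v) = w v \<and> y v \<noteq> v"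
    if "v \<in> ?V" for v using y0 that by (simp add: w_def)
  have wa: "w a = \<beta>" using y0 V by (simp add: w_def)
  let ?X = "?V <+> ?E"
  let ?Y = "(\<lambda>v. if cv v = w v then Inl v else Inr {v, y v}) ` ?V"
  note Y = witness_set[where V = ?V and E = ?E and cv = cv and ce = ce and y = y and w = w,
      OF fin(1) subset_refl y]
  have X: "finite ?X" "card ?X = card ?V + card ?E" using fin by (auto simp: card_Plus)
  \<comment> \<open>A charged edge differs in color from the end that charges it, so an edge sharing
    its color with both ends is uncharged.\<close>
  have inner: "Inr {s, t} \<notin> ?Y" if "cv s = ce {s, t}" "cv t = ce {s, t}" for s t
  proof
    assume "Inr {s, t} \<in> ?Y"
    then obtain v where v: "cv v \<noteq> w v" "{s, t} = {v, y v}" by (auto split: if_splits)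
    then have "w v = ce {s, t}" "v = s \<or> v = t" by (auto simp: w_def doubleton_eq_iff insert_commute)
    then show False using v that by auto
  qed
  \<comment> \<open>Two uncharged elements have color \<open>\<alpha>\<close>: the vertex
    \<open>a\<close> and the edge \<open>{a, y2}\<close> if
    \<open>\<alpha> \<noteq> \<beta>\<close>, otherwise the first and the last edge of the walk from
    \<open>a\<close> to \<open>b\<close>, distinct because \<open>a\<close> and \<open>b\<close> are
    not adjacent.\<close>
  have "card (cv ` ?V \<union> ce ` ?E) < card (?X - ?Y)"
  proof (cases "\<alpha> = \<beta>")
    case False
    have "Inl a \<notin> ?Y" using wa \<alpha>(3) False by (auto split: if_splits)
    moreover have "Inr {a, y2} \<notin> ?Y" using inner \<alpha> y2 by simp
    ultimately have "card (case_sum cv ce ` (?X - ?Y)) < card (?X - ?Y)"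
      using X V y2 \<alpha> by (intro card_image_less[of _ "Inl a" "Inr {a, y2}"]) auto
    then show ?thesis using Y(3) by simp
  next
    case True
    have "Inr {a, y2} \<notin> ?Y" using inner \<alpha> y2 by simp
    moreover have "Inr {z, b} \<notin> ?Y" using inner \<beta> z True by simp
    moreover have "{a, y2} \<noteq> {z, b}" using y2(1) nab d by (auto simp: doubleton_eq_iff)
    ultimately have "card (case_sum cv ce ` (?X - ?Y)) < card (?X - ?Y)"
      using X y2 z by (intro card_image_less[of _ "Inr {a, y2}" "Inr {z, b}"]) auto
    then show ?thesis using Y(3) by simp
  qed
  moreover have "card (?X - ?Y) = card ?X - card ?V"
    using Y(1,2) fin by (simp add: card_Diff_subset)
  ultimately show ?thesis using X card_ear_edges[OF e] by simp
qed

text \<open>With one internal vertex, charging all vertices gives the exact count. A longer ear is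
  contracted at a crossed vertex. If none is crossed and there are at least three, both neighbours
  of the second one are uncrossed ear vertices, so it cannot reach \<open>a\<close>.\<close>

lemma ear_colors:
  assumes "ear C D a b xs" "TMC_coloring (ear_vertices C b xs) (ear_edges C D a b xs) cv ce"
  shows "card (cv ` ear_vertices C b xs \<union> ce ` ear_edges C D a b xs) \<le> (card C choose 2) + card D + 2"
  using assms
proof (induction "length xs" arbitrary: xs ce rule: less_induct)
  case less
  note e = less.prems(1) and T = less.prems(2)
  let ?V = "ear_vertices C b xs" and ?E = "ear_edges C D a b xs"
  have E: "?E \<subseteq> [?V]\<^bsup>2\<^esup>" using ear_edges_nsets[OF e] .
  have fin: "finite ?V" using finite_ear[OF e] by auto
  have d: "a \<in> C" "b \<notin> C" "D \<subseteq> C - {a}" "set xs \<inter> insert b C = {}" "finite C" "2 \<le> card C"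
    "xs \<noteq> []" "distinct xs"
    using e by (auto simp: ear_def)
  show ?case
  proof (cases "length xs = 1")
    case True
    then obtain x where xs: "xs = [x]" by (cases xs) auto
    have Eeq: "?E = [C]\<^bsup>2\<^esup> \<union> (\<lambda>x. {b, x}) ` D \<union> {{a, x}, {x, b}}"
      by (simp add: ear_edges_def xs)
    have x: "x \<notin> insert b C" using d xs by auto
    have n: "y = a \<or> y = b" if "{x, y} \<in> ?E" for y
      using that d x unfolding Eeq by (auto simp: doubleton_eq_iff nsets_def)
    have nab: "{a, b} \<notin> ?E"
      using d x unfolding Eeq by (auto simp: doubleton_eq_iff nsets_def)
    have "C \<noteq> {a}" using d by auto
    then obtain c where c: "c \<in> C" "c \<noteq> a" using d by blast
    have "\<exists>u\<in>?V. u \<noteq> v \<and> {u, v} \<notin> ?E" if v: "v \<in> ?V" for v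
    proof -
      consider "v = a" | "v = b" | "v = x" | "v \<in> C" "v \<noteq> a" using v xs by (auto simp: ear_vertices_def)
      then show ?thesis
      proof cases
        case 1
        then show ?thesis using nab d by (intro bexI[of _ b]) (auto simp: ear_vertices_def insert_commute)
      next
        case 2
        then show ?thesis using nab d by (intro bexI[of _ a]) (auto simp: ear_vertices_def)
      next
        case 3
        then show ?thesis using n[of c] c x d
          by (intro bexI[of _ c]) (auto simp: ear_vertices_def insert_commute)
      next
        case 4
        then show ?thesis using n[of v] x d xs by (intro bexI[of _ x]) (auto simp: ear_vertices_def)
      qed
    qed
    then have "card (cv ` ?V \<union> ce ` ?E) + card ?V \<le> card ?V + card ?E"
      by (intro colors_le_nondominating[OF T E fin]) auto
    then show ?thesis using card_ear_edges[OF e] xs by simp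
  next
    case False
    show ?thesis
    proof (cases "\<exists>x\<in>set xs. \<exists>c. passes ?E cv ce c x")
      case True
      then obtain x c where x: "x \<in> set xs" "passes ?E cv ce c x" by blast
      then obtain ys zs where xs: "xs = ys @ x # zs" by (auto simp: in_set_conv_decomp)
      have ne: "ys @ zs \<noteq> []" using False xs by auto
      note con = ear_contract[OF e[unfolded xs] T[unfolded xs] x(2)[unfolded xs] ne]
      then obtain ce' where ce': "TMC_coloring (ear_vertices C b (ys @ zs)) (ear_edges C D a b (ys @ zs)) cv ce'"
        "cv ` ?V \<union> ce ` ?E \<subseteq> cv ` ear_vertices C b (ys @ zs) \<union> ce' ` ear_edges C D a b (ys @ zs)"
        unfolding xs by blast
      have "finite (cv ` ear_vertices C b (ys @ zs) \<union> ce' ` ear_edges C D a b (ys @ zs))"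
        using finite_ear[OF con(1)] finite_edges[OF ear_edges_nsets[OF con(1)]] by auto
      then have "card (cv ` ?V \<union> ce ` ?E) \<le>
          card (cv ` ear_vertices C b (ys @ zs) \<union> ce' ` ear_edges C D a b (ys @ zs))"
        using ce'(2) by (rule card_mono)
      also have "\<dots> \<le> (card C choose 2) + card D + 2"
        using less.hyps[OF _ con(1) ce'(1)] xs by simp
      finally show ?thesis .
    next
      case none: False
      obtain x1 x2 r where xs: "xs = x1 # x2 # r" using False d(7) by (cases xs rule: remdups_adj.cases) auto
      show ?thesis
      proof (cases r)
        case Nil
        show ?thesis using ear_colors_two[of C D a b x1 x2 cv ce] e T none unfolding xs Nil by auto
      next
        case (Cons x3 r')
        have "xs = [x1] @ x2 # x3 # r'" using xs Cons by simp
        from ear_split(5)[OF e[unfolded this], of "[a]" x1 x3 "r' @ [b]"]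
        have nb: "y = x1 \<or> y = x3" if "{x2, y} \<in> ?E" for y
          using that xs Cons by simp
        have "x2 \<noteq> a" "x2 \<in> ?V" "a \<in> ?V" "x1 \<noteq> a" "x3 \<noteq> a"
          using d xs Cons by (auto simp: ear_vertices_def)
        then obtain c where "walk (\<lambda>x y. {x, y} \<in> ?E \<and> ce {x, y} = c) (passes ?E cv ce c) x2 a"
          using TMC_walk[OF T \<open>x2 \<in> ?V\<close> \<open>a \<in> ?V\<close>] by blast
        then have False
        proof (cases rule: walk.cases)
          case edge
          then show ?thesis using nb[of a] \<open>x1 \<noteq> a\<close> \<open>x3 \<noteq> a\<close> by auto
        next
          case (step y)
          then show ?thesis using nb[of y] none xs Cons by auto
        qed
        then show ?thesis ..
      qed
    qed
  qed
qed

lemma ear_tmc_le: "ear C D a b xs \<Longrightarrow>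
    tmc (ear_vertices C b xs) (ear_edges C D a b xs) \<le> (card C choose 2) + card D + 2"
  by (rule tmc_le[OF ear_connected ear_colors])

section \<open>The thresholds\<close>

lemma conn_common_neighbour:
  assumes "\<And>x y. x \<in> V \<Longrightarrow> y \<in> V \<Longrightarrow> x \<noteq> y \<Longrightarrow>
    {x, y} \<in> E \<or> (\<exists>z\<in>V. {x, z} \<in> E \<and> {z, y} \<in> E)"
  shows "conn E V"
  unfolding conn_def
proof (intro allI impI)
  fix B assume B: "B \<subset> V" "B \<noteq> {}"
  then obtain x y where xy: "x \<in> B" "y \<in> V - B" "x \<in> V" by blast
  then consider "{x, y} \<in> E" | z where "z \<in> V" "{x, z} \<in> E" "{z, y} \<in> E"
    using assms[of x y] by blast
  then show "\<exists>x\<in>B. \<exists>y\<in>V - B. {x, y} \<in> E"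
    using xy by cases blast+
qed

text \<open>For \<open>2 * p \<le> N\<close> this is a star forest with centres below \<open>p\<close> covering the vertices below \<open>N\<close>.\<close>

definition star_forest :: "nat \<Rightarrow> nat \<Rightarrow> nat set set" where
  "star_forest p N = (\<lambda>j. {j, j mod p}) ` {p..<N}"

lemma star_forest_edgeD:
  assumes "1 \<le> p" "{x, y} \<in> star_forest p N"
  shows "x mod p = y mod p \<and> x < N \<and> y < N"
proof -
  obtain j where j: "p \<le> j" "j < N" "{x, y} = {j, j mod p}" using assms(2) by (auto simp: star_forest_def)
  have "j mod p < p" using assms(1) by simp
  then have "j mod p < N" using j by linarith
  then show ?thesis using j by (auto simp: doubleton_eq_iff)
qed

lemma star_forest_nsets:
  assumes "1 \<le> p" "N \<le> n"
  shows "star_forest p N \<subseteq> [{..<n}]\<^bsup>2\<^esup>"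
proof
  fix e assume "e \<in> star_forest p N"
  then obtain j where j: "p \<le> j" "j < N" "e = {j, j mod p}" by (auto simp: star_forest_def)
  have "j mod p < p" using assms by simp
  then have "j mod p < n" "j mod p \<noteq> j" using j assms by linarith+
  then show "e \<in> [{..<n}]\<^bsup>2\<^esup>" using j assms by auto
qed

lemma card_star_forest:
  assumes "1 \<le> p"
  shows "card (star_forest p N) = N - p"
proof -
  have "inj_on (\<lambda>j. {j, j mod p}) {p..<N}"
  proof (rule inj_onI)
    fix i j assume ij: "i \<in> {p..<N}" "j \<in> {p..<N}" "{i, i mod p} = {j, j mod p}"
    have "i mod p < p" "j mod p < p" using assms by simp_all
    then show "i = j" using ij by (auto simp: doubleton_eq_iff)
  qed
  then show ?thesis unfolding star_forest_def by (simp add: card_image)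
qed

text \<open>All \<open>N\<close> covered vertices have a non-neighbour and are charged. The
  complement would be disconnected if a single star covered everything, which \<open>c\<close>
  excludes.\<close>

lemma star_forest_graph:
  fixes p N n :: nat
  assumes p: "1 \<le> p" "2 * p \<le> N" "N \<le> n" and c: "2 \<le> p \<or> N < n"
  obtains E where "connected_graph {..<n} E" "card E + (N - p) = n choose 2"
    "tmc {..<n} E + N \<le> card E + n"
proof -
  let ?F = "star_forest p N"
  define E where "E = [{..<n}]\<^bsup>2\<^esup> - ?F"
  have F: "?F \<subseteq> [{..<n}]\<^bsup>2\<^esup>" using star_forest_nsets[OF p(1,3)] .
  have E: "E \<subseteq> [{..<n}]\<^bsup>2\<^esup>" by (auto simp: E_def)
  have fin: "finite ([{..<n}]\<^bsup>2\<^esup>)" by (simp add: finite_imp_finite_nsets)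
  have "card E = (n choose 2) - (N - p)"
    unfolding E_def using F finite_subset[OF F fin] card_star_forest[OF p(1), of N]
    by (simp add: card_Diff_subset)
  moreover have "N - p \<le> n choose 2"
    using card_mono[OF fin F] card_star_forest[OF p(1)] by simp
  ultimately have cE: "card E + (N - p) = n choose 2" by simp
  have "conn E {..<n}"
  proof (rule conn_common_neighbour)
    fix x y assume xy: "x \<in> {..<n}" "y \<in> {..<n}" "x \<noteq> y"
    show "{x, y} \<in> E \<or> (\<exists>z\<in>{..<n}. {x, z} \<in> E \<and> {z, y} \<in> E)"
    proof (cases "{x, y} \<in> ?F")
      case True
      have s: "x mod p = y mod p" "x < N" "y < N" using star_forest_edgeD[OF p(1) True] by auto
      show ?thesis
      proof (cases "N < n")
        case True
        have "{x, n - 1} \<notin> ?F" "{n - 1, y} \<notin> ?F"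
          using star_forest_edgeD[OF p(1), of x "n - 1" N] star_forest_edgeD[OF p(1), of "n - 1" y N] True by auto
        then have "{x, n - 1} \<in> E" "{n - 1, y} \<in> E" using s True by (auto simp: E_def)
        then show ?thesis using True by auto
      next
        case False
        \<comment> \<open>A vertex of another residue class lies in another star, so it is adjacent
          to both \<open>x\<close> and \<open>y\<close>.\<close>
        define z :: nat where "z = (if x mod p = 0 then 1 else 0)"
        have z: "z mod p \<noteq> x mod p" "z < n" using c False p by (auto simp: z_def)
        then have "{x, z} \<notin> ?F" "{z, y} \<notin> ?F"
          using star_forest_edgeD[OF p(1), of x z N] star_forest_edgeD[OF p(1), of z y N] s by auto
        moreover have "x \<noteq> z" "y \<noteq> z" using z s by auto
        ultimately have "{x, z} \<in> E" "{z, y} \<in> E" using z xy by (auto simp: E_def)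
        then show ?thesis using z by auto
      qed
    qed (use xy in \<open>auto simp: E_def\<close>)
  qed
  moreover have "{..<n} \<noteq> {}" using p by (auto simp: lessThan_empty_iff)
  ultimately have G: "connected_graph {..<n} E" by (intro conn_connected_graph[OF E]) auto
  have "tmc {..<n} E \<le> card E + n - N"
  proof (rule tmc_le[OF G])
    fix cv :: "nat \<Rightarrow> nat" and ce
    assume T: "TMC_coloring {..<n} E cv ce"
    have "card (cv ` {..<n} \<union> ce ` E) + card {..<N} \<le> card {..<n} + card E"
    proof (rule colors_le_nondominating[OF T E])
      fix v assume v: "v \<in> {..<N}"
      show "\<exists>u\<in>{..<n}. u \<noteq> v \<and> {u, v} \<notin> E"
      proof (cases "p \<le> v")
        case True
        have "v mod p < p" using p by simp
        then have "v mod p < n" "v mod p \<noteq> v" using True p by linarith+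
        moreover have "{v mod p, v} \<in> ?F" using True v by (auto simp: star_forest_def insert_commute)
        ultimately show ?thesis by (intro bexI[of _ "v mod p"]) (auto simp: E_def)
      next
        case False
        \<comment> \<open>The centre \<open>v\<close> misses the leaf \<open>v + p\<close>, which is
          below \<open>N\<close> because \<open>2 * p \<le> N\<close>.\<close>
        then have "{v + p, (v + p) mod p} \<in> ?F" using p unfolding star_forest_def by (intro imageI) auto
        then have "{v + p, v} \<in> ?F" using False by simp
        then show ?thesis using False p by (intro bexI[of _ "v + p"]) (auto simp: E_def)
      qed
    qed (use p in auto)
    then show "card (cv ` {..<n} \<union> ce ` E) \<le> card E + n - N" by simp
  qed
  then show ?thesis using that[of E] G cE p by simp
qed

text \<open>The ear absorbs the \<open>n - 1 - t\<close> vertices between the clique and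
  \<open>b = n - 1\<close>, at least one since \<open>t + 2 \<le> n\<close>. The parameter
  \<open>d\<close> tunes the edge number between two triangular numbers.\<close>

lemma ear_graph:
  fixes n t d :: nat
  assumes t: "2 \<le> t" "t + 2 \<le> n" and d: "d + 1 \<le> t"
  obtains E where "connected_graph {..<n} E" "card E + t = (t choose 2) + d + n"
    "tmc {..<n} E \<le> (t choose 2) + d + 2"
proof -
  let ?C = "{..<t}" and ?xs = "[t..<n - 1]"
  have e: "ear ?C {..<d} (t - 1) (n - 1) ?xs" using assms by (auto simp: ear_def)
  have V: "ear_vertices ?C (n - 1) ?xs = {..<n}" using assms by (auto simp: ear_vertices_def)
  have "card (ear_edges ?C {..<d} (t - 1) (n - 1) ?xs) + t = (t choose 2) + d + n"
    using card_ear_edges[OF e] assms by simp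
  then show ?thesis using that ear_connected[OF e] ear_tmc_le[OF e] unfolding V by simp
qed

text \<open>One graph with at least \<open>m - 1\<close> edges and \<open>tmc\<close> below
  \<open>k\<close> refutes all smaller thresholds. At \<open>m = n - 1\<close> minimality is built
  into \<open>f_tmc\<close>.\<close>

lemma f_tmc_eqI:
  assumes "n - 1 \<le> m"
    and ge: "\<And>(V :: nat set) E. connected_graph V E \<Longrightarrow> card V = n \<Longrightarrow> m \<le> card E \<Longrightarrow> k \<le> tmc V E"
    and sharp: "m \<noteq> n - 1 \<Longrightarrow>
      \<exists>(V :: nat set) E. connected_graph V E \<and> card V = n \<and> m \<le> card E + 1 \<and> tmc V E < k"
  shows "f_tmc n k = m"
  unfolding f_tmc_def
proof (rule Least_equality)
  fix m' assume m': "n - 1 \<le> m' \<and> (\<forall>(V :: nat set) E.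
    connected_graph V E \<and> card V = n \<and> m' \<le> card E \<longrightarrow> k \<le> tmc V E)"
  show "m \<le> m'"
  proof (rule ccontr)
    assume "\<not> m \<le> m'"
    then obtain V :: "nat set" and E where
      "connected_graph V E" "card V = n" "m \<le> card E + 1" "tmc V E < k"
      using sharp m' by fastforce
    then show False using m' \<open>\<not> m \<le> m'\<close> by (metis Suc_eq_plus1 le_trans not_less not_less_eq_eq)
  qed
qed (use assms in auto)

section \<open>Evaluation of the threshold in each range of k\<close>

lemma connected_graph_card_edges:
  assumes "connected_graph V E"
  shows "card V \<le> card E + 1"
proof -
  have E: "E \<subseteq> [V]\<^bsup>2\<^esup>" "finite V" using connected_graph_simple[OF assms] by auto
  have "{e \<in> E. e \<subseteq> V} = E" using E by (auto simp: nsets_def)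
  then show ?thesis
    using conn_edges_ge[OF E(1) connected_graph_conn[OF assms] E(2)] by (simp add: edges_in_def)
qed

lemma card_compl_edges:
  assumes "E \<subseteq> [V]\<^bsup>2\<^esup>" "finite V"
  shows "card E + card ([V]\<^bsup>2\<^esup> - E) = card V choose 2"
proof -
  have "card ([V]\<^bsup>2\<^esup> - E) = (card V choose 2) - card E"
    using assms finite_edges[OF assms] by (simp add: card_Diff_subset)
  moreover have "card E \<le> card V choose 2"
    using card_mono[OF finite_imp_finite_nsets[OF assms(2)] assms(1)] by simp
  ultimately show ?thesis by simp
qed

text \<open>For at least three vertices the degree sum exceeds the order, so a vertex of degree two
  or more leads to a dominating set with two vertices outside. For two vertices the graph is a
  single edge, whose three elements may all differ.\<close>

lemma tmc_ge_3:
  assumes G: "connected_graph V E" and n: "2 \<le> card V"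
  shows "3 \<le> tmc V E"
proof -
  have E: "E \<subseteq> [V]\<^bsup>2\<^esup>" "finite V" using connected_graph_simple[OF G] by auto
  note c = connected_graph_conn[OF G]
  have m: "card V \<le> card E + 1" by (rule connected_graph_card_edges[OF G])
  show ?thesis
  proof (cases "card V = 2")
    case True
    then have "card ([V]\<^bsup>2\<^esup> - E) = 0" using card_compl_edges[OF E] m by simp
    then show ?thesis using tmc_ge_dense[OF E] True m by simp
  next
    case False
    have "\<exists>v\<in>V. \<not> deg_in E v V \<le> 1"
    proof (rule ccontr)
      assume "\<not> ?thesis"
      then have "(\<Sum>v\<in>V. deg_in E v V) \<le> card V"
        using sum_bounded_above[of V "\<lambda>v. deg_in E v V" 1] by simp
      moreover have "edges_in E V = card E"
        unfolding edges_in_def using E by (intro arg_cong[where f = card]) (auto simp: nsets_def)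
      ultimately show False using sum_deg_in[OF E] m n False by simp
    qed
    then obtain v where v: "v \<in> V" "2 \<le> deg_in E v V" by auto
    have "{y \<in> V. {v, y} \<in> E} = boundary E V {v}"
      using E by (auto simp: boundary_def nsets_def)
    then have "2 \<le> card (boundary E V {v})" using v by (simp add: deg_in_def)
    with v obtain D where D: "D \<subseteq> V" "D \<noteq> {}" "conn E D" "2 \<le> card (V - D)"
      "\<And>v. v \<in> V - D \<Longrightarrow> \<exists>x\<in>D. {v, x} \<in> E"
      using exists_dominating_conn[OF E c, of "{v}" 2] by auto
    show ?thesis using tmc_ge_dominating_set[OF E D(1-3,5)] D(4) m by linarith
  qed
qed

lemma choose_two_Suc: "Suc m choose 2 = (m choose 2) + m"
  by (simp add: numeral_2_eq_2)

lemma f_tmc_three: "2 \<le> n \<Longrightarrow> f_tmc n 3 = n - 1"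
  by (rule f_tmc_eqI) (auto intro: tmc_ge_3)

text \<open>As \<open>s \<le> t - 1\<close>, the edges still suffice for \<open>t\<close> vertices
  outside a dominating set, and the bound then equals \<open>k\<close>. The ear with
  \<open>d = t - 1 - s\<close> has one edge less and at most \<open>k - 1\<close> colors.\<close>

lemma f_tmc_sparse:
  assumes t: "2 \<le> t" "t + 2 \<le> n" and s: "s + 1 \<le> t" and k: "k + s = (t choose 2) + t + 2"
  shows "f_tmc n k + s = n + (t choose 2)"
proof -
  obtain u where u: "t = Suc u" using t by (cases t) auto
  have ct: "t choose 2 = (u choose 2) + u" unfolding u by (rule choose_two_Suc)
  define m where "m = n + (t choose 2) - s"
  have m: "m + s = n + (t choose 2)" using s ct u by (simp add: m_def)
  have "f_tmc n k = m"
  proof (rule f_tmc_eqI)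
    show "n - 1 \<le> m" using m ct s u by simp
  next
    fix V :: "nat set" and E assume G: "connected_graph V E" "card V = n" "m \<le> card E"
    have E: "E \<subseteq> [V]\<^bsup>2\<^esup>" "finite V" using connected_graph_simple[OF G(1)] by auto
    have "card E + 2 + t \<le> tmc V E + card V"
    proof (rule tmc_ge_sparse[OF E connected_graph_conn[OF G(1)]])
      show "card V + ((t - 1) choose 2) \<le> card E" using G m ct s u by simp
    qed (use t G in auto)
    then show "k \<le> tmc V E" using G k m by simp
  next
    obtain d where d: "t = s + 1 + d" using s le_Suc_ex by blast
    then have "d + 1 \<le> t" by simp
    from ear_graph[OF t this] obtain E where E: "connected_graph {..<n} E"
      "card E + t = (t choose 2) + d + n" "tmc {..<n} E \<le> (t choose 2) + d + 2" .
    have "m \<le> card E + 1" "tmc {..<n} E < k" using E m k d by linarith+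
    with E(1) show "\<exists>(V :: nat set) E. connected_graph V E \<and> card V = n \<and> m \<le> card E + 1 \<and> tmc V E < k"
      by (intro exI[of _ "{..<n}"] exI[of _ E]) simp
  qed
  then show ?thesis using m by simp
qed

text \<open>Serves \<open>tmc_ge_sparse\<close> at \<open>t = n - 2\<close>, where the edge
  requirement involves \<open>(n - 3) choose 2\<close>.\<close>

lemma choose_two_minus_three:
  assumes "3 \<le> n"
  shows "(n choose 2) + 6 = ((n - 3) choose 2) + 3 * n"
proof -
  have "n = Suc (Suc (Suc (n - 3)))" using assms by simp
  then obtain u where "n = Suc (Suc (Suc u))" ..
  then show ?thesis by (simp add: choose_two_Suc)
qed

text \<open>At \<open>t = n - 2\<close> the dominating set bound becomes
  \<open>tmc \<ge> card E\<close>; complements of spanning star forests have no more colors than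
  that.\<close>

lemma f_tmc_middle:
  assumes lo: "(n choose 2) + 4 \<le> k + n" and hi: "k + 3 * (n div 2) \<le> (n choose 2) + n"
    and ex: "\<not> (odd n \<and> k + 3 * (n div 2) = (n choose 2) + n)"
  shows "f_tmc n k = k"
proof -
  have ex': "k + 3 * (n div 2) + 1 \<le> (n choose 2) + n" if "odd n" using hi ex that by linarith
  have "3 * (n div 2) + 4 \<le> 2 * n" using lo hi by linarith
  moreover have "3 * (n div 2) + 5 \<le> 2 * n" if "odd n" using lo ex'[OF that] by linarith
  ultimately have n: "7 \<le> n" by presburger
  have c: "(n choose 2) + 6 = ((n - 3) choose 2) + 3 * n" using n by (intro choose_two_minus_three) simp
  show ?thesis
  proof (rule f_tmc_eqI)
    show "n - 1 \<le> k" using lo c by simp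
  next
    fix V :: "nat set" and E assume G: "connected_graph V E" "card V = n" "k \<le> card E"
    have E: "E \<subseteq> [V]\<^bsup>2\<^esup>" "finite V" using connected_graph_simple[OF G(1)] by auto
    have "card E + 2 + (n - 2) \<le> tmc V E + card V"
    proof (rule tmc_ge_sparse[OF E connected_graph_conn[OF G(1)]])
      show "card V + ((n - 2 - 1) choose 2) \<le> card E" using G lo c n by simp
    qed (use n G in auto)
    then show "k \<le> tmc V E" using G n by simp
  next
    \<comment> \<open>Removing \<open>p\<close> stars that cover all vertices leaves
      \<open>k - 1\<close> edges. In the case excluded for odd \<open>n\<close>, \<open>p\<close>
      would be \<open>n div 2 + 1\<close> and \<open>2 * p \<le> n\<close> would fail.\<close>
    define p where "p = n + k - 1 - (n choose 2)"
    have p: "p + (n choose 2) + 1 = n + k" using lo by (simp add: p_def)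
    have "p + 1 + 3 * (n div 2) \<le> 2 * n" using p hi by linarith
    moreover have "p + 2 + 3 * (n div 2) \<le> 2 * n" if "odd n" using p ex'[OF that] by linarith
    ultimately have "2 * p \<le> n" by presburger
    moreover have "3 \<le> p" using p lo by simp
    ultimately obtain E where E: "connected_graph {..<n} E" "card E + (n - p) = n choose 2"
      "tmc {..<n} E + n \<le> card E + n" using star_forest_graph[of p n n] by auto
    have "card E + n = (n choose 2) + p" using E(2) \<open>2 * p \<le> n\<close> by simp
    then have "k \<le> card E + 1" "tmc {..<n} E < k" using E(3) p by linarith+
    with E(1) show "\<exists>(V :: nat set) E. connected_graph V E \<and> card V = n \<and> k \<le> card E + 1 \<and> tmc V E < k"
      by (intro exI[of _ "{..<n}"] exI[of _ E]) simp
  qed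
qed

text \<open>Each missing edge costs three: itself and at most two edges at the dominating vertex
  that lose their private colors.\<close>

lemma tmc_ge_few_missing:
  assumes G: "connected_graph V E" "card V = n" "(n choose 2) \<le> card E + r" and r: "2 * r < n"
  shows "n + (n choose 2) \<le> tmc V E + 3 * r"
proof -
  have E: "E \<subseteq> [V]\<^bsup>2\<^esup>" "finite V" using connected_graph_simple[OF G(1)] by auto
  show ?thesis using tmc_ge_dense[OF E] card_compl_edges[OF E] G r by simp
qed

lemma choose_two_ge: "n \<le> (n choose 2) + 1"
  by (induction n) (auto simp: choose_two_Suc)

lemma choose_two_ge': "4 \<le> n \<Longrightarrow> n + n div 2 \<le> (n choose 2) + 1"
proof (induction n rule: dec_induct)
  case (step n)
  then show ?case by (simp add: choose_two_Suc)
qed (simp add: choose_two)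

text \<open>For sharpness a matching of \<open>r + 1\<close> edges is removed:
  \<open>star_forest (r + 1) (2 * (r + 1))\<close> pairs each \<open>j\<close> with
  \<open>j - (r + 1)\<close>.\<close>

lemma f_tmc_dense:
  assumes r: "2 * r + 2 \<le> n" and k: "(n choose 2) + n < k + 3 * (r + 1)" "k + 3 * r \<le> (n choose 2) + n"
  shows "f_tmc n k + r = n choose 2"
proof -
  have c: "n - 1 + r \<le> n choose 2"
  proof (cases "n < 4")
    case True
    then have "r = 0" using r by simp
    then show ?thesis using choose_two_ge[of n] by simp
  next
    case False
    then show ?thesis using choose_two_ge'[of n] r by simp
  qed
  define m where "m = (n choose 2) - r"
  have m: "m + r = n choose 2" using c by (simp add: m_def)
  have "f_tmc n k = m"
  proof (rule f_tmc_eqI)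
    show "n - 1 \<le> m" using m c by simp
  next
    fix V :: "nat set" and E assume "connected_graph V E" "card V = n" "m \<le> card E"
    then show "k \<le> tmc V E" using tmc_ge_few_missing[of V E n r] m r k by simp
  next
    assume "m \<noteq> n - 1"
    \<comment> \<open>For \<open>n = 2\<close> and \<open>r = 0\<close> removing the matching would
      disconnect the graph; that is a case with \<open>m = n - 1\<close>.\<close>
    have "2 \<le> r + 1 \<or> 2 * (r + 1) < n"
    proof (rule ccontr)
      assume "\<not> ?thesis"
      then have "r = 0" "n = 2" using r by auto
      then show False using \<open>m \<noteq> n - 1\<close> m by (simp add: choose_two)
    qed
    then obtain E where E: "connected_graph {..<n} E" "card E + (2 * (r + 1) - (r + 1)) = n choose 2"
      "tmc {..<n} E + 2 * (r + 1) \<le> card E + n"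
      using star_forest_graph[of "r + 1" "2 * (r + 1)" n] r by auto
    then show "\<exists>(V :: nat set) E. connected_graph V E \<and> card V = n \<and> m \<le> card E + 1 \<and> tmc V E < k"
      using m k by (intro exI[of _ "{..<n}"] exI[of _ E]) simp
  qed
  then show ?thesis using m by simp
qed

text \<open>With \<open>n div 2\<close> missing edges some vertex is still untouched, as
  \<open>n\<close> is odd. A matching with one edge more does not fit, so sharpness uses
  \<open>n div 2\<close> stars covering everything: a matching with a second leaf at one
  centre.\<close>

lemma f_tmc_odd:
  assumes n: "odd n" "3 \<le> n" and k: "k + 3 * (n div 2) = (n choose 2) + n"
  shows "f_tmc n k + n div 2 = n choose 2"
proof -
  define h where "h = n div 2"
  have h: "n = 2 * h + 1" using n by (simp add: h_def)
  have kh: "k + 3 * h = (n choose 2) + n" using k by (simp add: h_def)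
  have c: "n - 1 + h \<le> n choose 2"
  proof (cases "n < 4")
    case True
    then have "n = 3" using n by simp
    then show ?thesis by (simp add: h_def choose_two)
  next
    case False
    then show ?thesis using choose_two_ge'[of n] h_def by simp
  qed
  define m where "m = (n choose 2) - h"
  have m: "m + h = n choose 2" using c by (simp add: m_def)
  have "f_tmc n k = m"
  proof (rule f_tmc_eqI)
    show "n - 1 \<le> m" using m c by simp
  next
    fix V :: "nat set" and E assume "connected_graph V E" "card V = n" "m \<le> card E"
    then have "n + (n choose 2) \<le> tmc V E + 3 * h" using m h by (intro tmc_ge_few_missing) auto
    then show "k \<le> tmc V E" using kh by linarith
  next
    assume "m \<noteq> n - 1"
    \<comment> \<open>For \<open>n = 3\<close> removing the single star would isolate its centre;
      there \<open>m = n - 1\<close>.\<close>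
    have "2 \<le> h"
    proof (rule ccontr)
      assume "\<not> ?thesis"
      then have "h = 1" "n = 3" using n h by auto
      then show False using \<open>m \<noteq> n - 1\<close> m by (simp add: choose_two)
    qed
    then obtain E where E: "connected_graph {..<n} E" "card E + (n - h) = n choose 2"
      "tmc {..<n} E + n \<le> card E + n"
      using star_forest_graph[of h n n] h by auto
    then show "\<exists>(V :: nat set) E. connected_graph V E \<and> card V = n \<and> m \<le> card E + 1 \<and> tmc V E < k"
      using m kh h by (intro exI[of _ "{..<n}"] exI[of _ E]) simp
  qed
  then show ?thesis using m h_def by simp
qed

text \<open>Applied to \<open>x = k - 3\<close>: as
  \<open>Suc t choose 2 = (t choose 2) + t\<close>, the number
  \<open>s = (t choose 2) + t + 2 - k\<close> then ranges over \<open>0..t - 1\<close>, as in the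
  formula for small \<open>k\<close>.\<close>

lemma between_triangular:
  assumes "1 \<le> x"
  obtains t where "2 \<le> t" "t choose 2 \<le> x" "x < Suc t choose 2"
proof -
  have "\<exists>t\<ge>2. t choose 2 \<le> x \<and> x < Suc t choose 2"
    using assms
  proof (induction x rule: dec_induct)
    case base
    show ?case by (intro exI[of _ 2]) (simp add: choose_two)
  next
    case (step x)
    then obtain t where t: "2 \<le> t" "t choose 2 \<le> x" "x < Suc t choose 2" by blast
    show ?case
    proof (cases "Suc x < Suc t choose 2")
      case True
      then show ?thesis using t by (intro exI[of _ t]) auto
    next
      case False
      then show ?thesis using t choose_two_Suc[of "Suc t"] by (intro exI[of _ "Suc t"]) auto
    qed
  qed
  then show ?thesis using that by blast
qed

lemma f_tmc_cases:
  fixes n k :: nat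
  assumes "n \<ge> 1" and "3 \<le> k" and "k \<le> (n choose 2) + n"
  obtains "k = 3"
  | s t where "s + 1 \<le> t" "2 \<le> t" "t + 2 \<le> n" "k + s = (t choose 2) + t + 2"
  | "(n choose 2) + 4 \<le> k + n" "k + 3 * (n div 2) \<le> (n choose 2) + n"
    "\<not> (odd n \<and> k + 3 * (n div 2) = (n choose 2) + n)"
  | r where "2 * r + 2 \<le> n" "(n choose 2) + n < k + 3 * (r + 1)" "k + 3 * r \<le> (n choose 2) + n"
  | "odd n" "k + 3 * (n div 2) = (n choose 2) + n"
proof -
  consider "(n choose 2) + n < k + 3 * (n div 2)" | "k = 3"
    | "k + 3 * (n div 2) \<le> (n choose 2) + n" "(n choose 2) + 4 \<le> k + n"
    | "4 \<le> k" "k + n \<le> (n choose 2) + 3" using assms by linarith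
  then show thesis
  proof cases
    case 1
    obtain q where q: "(n choose 2) + n = k + q" using assms(3) le_Suc_ex by blast
    \<comment> \<open>At three colors per missing edge, \<open>r\<close> is the number of missing
      edges that \<open>k\<close> tolerates.\<close>
    define r where "r = q div 3"
    have r: "3 * r \<le> q" "q < 3 * r + 3" unfolding r_def by presburger+
    have "3 * r < 3 * (n div 2)" using q r 1 by linarith
    then have "2 * r + 2 \<le> n" by presburger
    moreover have "(n choose 2) + n < k + 3 * (r + 1)" using q r by simp
    moreover have "k + 3 * r \<le> (n choose 2) + n" using q r by simp
    ultimately show ?thesis by (rule that(4))
  next
    case 2
    then show ?thesis using that(1) by blast
  next
    case 3
    then show ?thesis using that(3,5) by blast
  next
    case 4
    then have "1 \<le> k - 3" by simp
    then obtain t where t: "2 \<le> t" "t choose 2 \<le> k - 3" "k - 3 < Suc t choose 2"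
      by (rule between_triangular)
    obtain u where u: "n = Suc u" using assms by (cases n) auto
    \<comment> \<open>\<open>t \<ge> n - 1\<close> would give
      \<open>k - 3 \<ge> (n - 1) choose 2\<close>, but in this range \<open>k - 3\<close> is at most
      \<open>(n choose 2) - n = ((n - 1) choose 2) - 1\<close>.\<close>
    have "t < u"
    proof (rule ccontr)
      assume "\<not> ?thesis"
      then have "u choose 2 \<le> t choose 2"
        by (intro binomial_right_mono) simp
      then show False using t 4 u choose_two_Suc[of u] by simp
    qed
    then show ?thesis using t 4 u choose_two_Suc[of t] that(2)[of "(t choose 2) + t + 2 - k" t] by simp
  qed
qed

text \<open>Both sides determine \<open>v\<close>, so the equivalence says that some clause applies
  and that all applicable clauses agree. They can overlap, as for \<open>n = 2\<close> and
  \<open>k = 3\<close>; each clause is therefore matched with \<open>f_tmc\<close> on its own, and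
  exhaustiveness is shown separately. Integers avoid truncated subtraction.\<close>

theorem theorem3:
  fixes n k :: nat and v :: int
  assumes "n \<ge> 1" and "3 \<le> k" and "k \<le> (n choose 2) + n"
  shows "int (f_tmc n k) = v \<longleftrightarrow>
      (k = 3 \<and> v = int n - 1)
    \<or> (\<exists>s t :: nat. int s \<le> int t - 1 \<and> 2 \<le> t \<and> int t \<le> int n - 2 \<and>
         int k = int (t choose 2) + int t + 2 - int s \<and>
         v = int n + int k - int t - 2)
    \<or> (int (n choose 2) - int n + 4 \<le> int k \<and>
       int k \<le> int (n choose 2) + int n - 3 * int (n div 2) \<and>
       \<not> (odd n \<and> int k = int (n choose 2) + int n - 3 * int (n div 2)) \<and>
       v = int k)
    \<or> (\<exists>r :: nat.
         ((int r \<le> int (n div 2) - 1 \<and>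
           int (n choose 2) + int n - 3 * (int r + 1) < int k \<and>
           int k \<le> int (n choose 2) + int n - 3 * int r)
          \<or> (odd n \<and> r = n div 2 \<and>
             int k = int (n choose 2) + int n - 3 * int (n div 2))) \<and>
         v = int (n choose 2) - int r)"
    (is "_ \<longleftrightarrow> ?A v \<or> ?B v \<or> ?C v \<or> ?D v")
proof -
  have n2: "2 \<le> n" using assms by (cases "n = 1") (auto simp: choose_two)
  have A: "int (f_tmc n k) = v" if "?A v" for v
    using that f_tmc_three[OF n2] n2 by auto
  have B: "int (f_tmc n k) = v" if "?B v" for v
  proof -
    from that obtain s t :: nat where st: "int s \<le> int t - 1" "2 \<le> t" "int t \<le> int n - 2"
      "int k = int (t choose 2) + int t + 2 - int s" "v = int n + int k - int t - 2" by blast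
    have "f_tmc n k + s = n + (t choose 2)" using st by (intro f_tmc_sparse) linarith+
    then show ?thesis using st by linarith
  qed
  have C: "int (f_tmc n k) = v" if "?C v" for v
  proof -
    have "f_tmc n k = k"
    proof (rule f_tmc_middle)
      show "\<not> (odd n \<and> k + 3 * (n div 2) = (n choose 2) + n)" using that by linarith
    qed (use that in linarith)+
    then show ?thesis using that by simp
  qed
  have D: "int (f_tmc n k) = v" if "?D v" for v
  proof -
    from that obtain r :: nat where v: "v = int (n choose 2) - int r" and r:
      "(int r \<le> int (n div 2) - 1 \<and> int (n choose 2) + int n - 3 * (int r + 1) < int k \<and>
        int k \<le> int (n choose 2) + int n - 3 * int r) \<or>
       (odd n \<and> r = n div 2 \<and> int k = int (n choose 2) + int n - 3 * int (n div 2))" by blast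
    consider "2 * r + 2 \<le> n" "(n choose 2) + n < k + 3 * (r + 1)" "k + 3 * r \<le> (n choose 2) + n"
      | "odd n" "r = n div 2" "k + 3 * (n div 2) = (n choose 2) + n"
      using r
    proof (elim disjE conjE)
      assume a: "int r \<le> int (n div 2) - 1" "int (n choose 2) + int n - 3 * (int r + 1) < int k"
        "int k \<le> int (n choose 2) + int n - 3 * int r"
      have "2 * (n div 2) \<le> n" by simp
      then have "2 * r + 2 \<le> n" using a(1) by linarith
      moreover have "int (n choose 2) + int n < int k + 3 * int r + 3" using a(2) by simp
      then have "(n choose 2) + n < k + 3 * r + 3" by linarith
      then have "(n choose 2) + n < k + 3 * (r + 1)" by simp
      moreover have "k + 3 * r \<le> (n choose 2) + n" using a(3) by linarith
      ultimately show ?thesis by (rule that(1))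
    next
      assume "odd n" "r = n div 2" and k: "int k = int (n choose 2) + int n - 3 * int (n div 2)"
      moreover have "k + 3 * (n div 2) = (n choose 2) + n" using k by linarith
      ultimately show ?thesis by (intro that(2))
    qed
    then have "f_tmc n k + r = n choose 2"
    proof cases
      case 1
      then show ?thesis by (rule f_tmc_dense)
    next
      case 2
      have "n \<noteq> 2" using 2 by auto
      then show ?thesis using f_tmc_odd[of n k] 2 n2 by simp
    qed
    then show ?thesis using v by linarith
  qed
  from assms have "\<exists>w. ?A w \<or> ?B w \<or> ?C w \<or> ?D w"
  proof (cases rule: f_tmc_cases)
    case 1
    then show ?thesis by blast
  next
    case (2 s t)
    then have "int s \<le> int t - 1 \<and> 2 \<le> t \<and> int t \<le> int n - 2 \<and>
         int k = int (t choose 2) + int t + 2 - int s" by linarith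
    then have "?B (int n + int k - int t - 2)" by blast
    then show ?thesis by blast
  next
    case 3
    then have "?C (int k)" by linarith
    then show ?thesis by blast
  next
    case (4 r)
    have "r + 1 \<le> n div 2" using 4(1) by linarith
    then have "int r \<le> int (n div 2) - 1" by linarith
    moreover have "(n choose 2) + n < k + 3 * r + 3" using 4(2) by simp
    then have "int (n choose 2) + int n < int k + (3 * int r + 3)" by linarith
    then have "int (n choose 2) + int n - 3 * (int r + 1) < int k" by simp
    moreover have "int k \<le> int (n choose 2) + int n - 3 * int r" using 4(3) by linarith
    ultimately have "int r \<le> int (n div 2) - 1 \<and> int (n choose 2) + int n - 3 * (int r + 1) < int k \<and>
        int k \<le> int (n choose 2) + int n - 3 * int r" by blast
    then have "?D (int (n choose 2) - int r)" by blast
    then show ?thesis by blast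
  next
    case 5
    then have "odd n \<and> n div 2 = n div 2 \<and> int k = int (n choose 2) + int n - 3 * int (n div 2)"
      by linarith
    then have "?D (int (n choose 2) - int (n div 2))" by blast
    then show ?thesis by blast
  qed
  then obtain w where w: "?A w \<or> ?B w \<or> ?C w \<or> ?D w" ..
  then have "int (f_tmc n k) = w" by (elim disjE[of "?A w"] disjE[of "?B w"] disjE[of "?C w"]) (rule A B C D, assumption)+
  with w have f: "?A (int (f_tmc n k)) \<or> ?B (int (f_tmc n k)) \<or> ?C (int (f_tmc n k)) \<or> ?D (int (f_tmc n k))"
    by (simp only:)
  show ?thesis
  proof
    assume "int (f_tmc n k) = v"
    with f show "?A v \<or> ?B v \<or> ?C v \<or> ?D v" by (simp only:)
  next
    assume "?A v \<or> ?B v \<or> ?C v \<or> ?D v"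
    then show "int (f_tmc n k) = v"
      by (elim disjE[of "?A v"] disjE[of "?B v"] disjE[of "?C v"]) (rule A B C D, assumption)+
  qed
qed

end
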